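(* Let $n\ge 2$. The maximum of $\mathcal S$ over all qubit states $\{\rho^{(j)}_{a|x}\}$ ($j\in\{1,\dots,n\}$, $a,x\in\{0,1\}$) and all $2^n$-outcome POVMs $\{\mathcal M_s\}_{s\in\{0,1\}^n}$ on $(\mathbb C^2)^{\otimes n}$ equals $1$. Moreover, if $\mathcal S=1$ for some qubit states $\{\rho^{(j)}_{a|x}\}$ and some POVM $\{\mathcal M_s\}_s$, then there exist unitaries $U_1,\dots,U_n$ on $\mathbb C^2$ such that $$U_1\rho^{(1)}_{0|0}U_1^\dagger=|\beta_+\rangle\langle\beta_+|,\quad U_1\rho^{(1)}_{1|0}U_1^\dagger=|\beta_-\rangle\langle\beta_-|,\quad U_1\rho^{(1)}_{0|1}U_1^\dagger=|\alpha_+\rangle\langle\alpha_+|,\quad U_1\rho^{(1)}_{1|1}U_1^\dagger=|\alpha_-\rangle\langle\alpha_-|,$$ for every $j\in\{2,\dots,n\}$ $$U_j\rho^{(j)}_{0|0}U_j^\dagger=|+\rangle\langle+|,\quad U_j\rho^{(j)}_{1|0}U_j^\dagger=|-\rangle\langle-|,\quad U_j\rho^{(j)}_{0|1}U_j^\dagger=|0\rangle\langle0|,\quad U_j\rho^{(j)}_{1|1}U_j^\dagger=|1\rangle\langle1|,$$ and for every $s\in\{0,1\}^n$ $$\Big(\bigotimes_{j=1}^nU_j\Big)\mathcal M_s\Big(\bigotimes_{j=1}^nU_j\Big)^\dagger=|\xi_s\rangle\langle\xi_s|.$$ Here $$|\beta_+\rangle=\cos\tfrac\pi8|0\rangle+\sin\tfrac\pi8|1\rangle,\quad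 |\beta_-\rangle=\sin\tfrac\pi8|0\rangle-\cos\tfrac\pi8|1\rangle,\quad |\alpha_+\rangle=\sin\tfrac\pi8|0\rangle+\cos\tfrac\pi8|1\rangle,\quad |\alpha_-\rangle=\cos\tfrac\pi8|0\rangle-\sin\tfrac\pi8|1\rangle,$$ and $$|\xi_s\rangle=\tfrac1{\sqrt2}\big(|0\,s_2\cdots s_n\rangle+(-1)^{s_1}|1\,\overline{s_2}\cdots\overline{s_n}\rangle\big),\qquad \overline{s_j}=1-s_j .$$
   Context: There are $n$ senders and one receiver. Sender $j$, on input $(a_j,x_j)\in\{0,1\}^2$, sends a qubit state (density operator on $\mathbb C^2$) $\rho^{(j)}_{a_j|x_j}$. The receiver has no input and performs on the $n$ received qubits (tensor factors ordered $1,\dots,n$) a POVM $\{\mathcal M_s\}_s$ (positive semidefinite operators with $\sum_s\mathcal M_s=\mathbb 1$) whose outcomes are $n$-bit strings $s=s_ns_{n-1}\cdots s_1$. Define $\mathcal A^{(j)}_{x}=\rho^{(j)}_{0|x}-\rho^{(j)}_{1|x}$ and, for each $s$, $$\mathcal W_s=(n-1)(-1)^{s_1}\big(\mathcal A^{(1)}_0+\mathcal A^{(1)}_1\big)\otimes\bigotimes_{j=2}^n\mathcal A^{(j)}_0+\sum_{j=2}^n(-1)^{s_j}\big(\mathcal A^{(1)}_0-\mathcal A^{(1)}_1\big)\otimes\mathcal A^{(j)}_1,$$ where in the second sum $\mathcal A^{(1)}$ acts on qubit $1$, $\mathcal A^{(j)}_1$ acts on qubit $j$, and the identity acts on all other qubits.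 The success metric is $$\mathcal S=\frac1{2^n(n-1)2\sqrt2}\sum_{s\in\{0,1\}^n}\operatorname{Tr}(\mathcal M_s\mathcal W_s).$$ $|0\rangle,|1\rangle$ is the computational basis of $\mathbb C^2$ and $|\pm\rangle=(|0\rangle\pm|1\rangle)/\sqrt2$. *)

theory Defs
  imports
    Complex_Main
    "HOL-Library.FuncSet"
    "HOL-Library.Complex_Order"
    "Jordan_Normal_Form.Schur_Decomposition"
begin

definition mat_trace :: "complex mat \<Rightarrow> complex" where
  "mat_trace A = (\<Sum>i<dim_row A. A $$ (i, i))"

definition mat_sum :: "nat \<Rightarrow> ('i \<Rightarrow> complex mat) \<Rightarrow> 'i set \<Rightarrow> complex mat" where
  "mat_sum d f I = mat d d (\<lambda>(i, k). \<Sum>x\<in>I. f x $$ (i, k))"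

text \<open>The order on \<^typ>\<open>complex\<close> is \<open>Re x \<le> Re y \<and> Im x = Im y\<close>, so \<open>0 \<le> z\<close> says that \<open>z\<close> is
  real and nonnegative.\<close>

definition psd :: "nat \<Rightarrow> complex mat \<Rightarrow> bool" where
  "psd d A \<longleftrightarrow> A \<in> carrier_mat d d \<and> mat_adjoint A = A \<and>
     (\<forall>v\<in>carrier_vec d. 0 \<le> (A *\<^sub>v v) \<bullet>c v)"

definition unitary_mat :: "nat \<Rightarrow> complex mat \<Rightarrow> bool" where
  "unitary_mat d U \<longleftrightarrow> U \<in> carrier_mat d d \<and>
     U * mat_adjoint U = 1\<^sub>m d \<and> mat_adjoint U * U = 1\<^sub>m d"

definition density :: "complex mat \<Rightarrow> bool" where
  "density \<rho> \<longleftrightarrow> psd 2 \<rho> \<and> mat_trace \<rho> = 1"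

definition kron :: "complex mat \<Rightarrow> complex mat \<Rightarrow> complex mat" where
  "kron A B = mat (dim_row A * dim_row B) (dim_col A * dim_col B)
     (\<lambda>(i, k). A $$ (i div dim_row B, k div dim_col B) * B $$ (i mod dim_row B, k mod dim_col B))"

text \<open>\<open>tensor n A\<close> is the Kronecker product of \<open>A 1, \<dots>, A n\<close>, in this order. Kets are represented by
  one-column matrices, so that \<open>tensor\<close> serves for operators and for kets alike.\<close>

definition tensor :: "nat \<Rightarrow> (nat \<Rightarrow> complex mat) \<Rightarrow> complex mat" where
  "tensor n A = foldr kron (map A [1..<Suc n]) (1\<^sub>m 1)"

definition ket2 :: "complex \<Rightarrow> complex \<Rightarrow> complex mat" where
  "ket2 a b = mat_of_rows_list 1 [[a], [b]]"

definition ket :: "nat \<Rightarrow> complex mat" where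
  "ket b = (if b = 0 then ket2 1 0 else ket2 0 1)"

definition proj :: "complex mat \<Rightarrow> complex mat" where
  "proj \<psi> = \<psi> * mat_adjoint \<psi>"

definition conj_by :: "complex mat \<Rightarrow> complex mat \<Rightarrow> complex mat" where
  "conj_by U A = U * A * mat_adjoint U"

text \<open>The bit \<open>s\<^sub>j\<close> of a string \<open>s\<close> is \<open>s j\<close>, for \<open>j = 1, \<dots>, n\<close>; the restriction to extensional
  functions makes the \<open>2 ^ n\<close> strings distinct elements.\<close>

definition bitstrings :: "nat \<Rightarrow> (nat \<Rightarrow> nat) set" where
  "bitstrings n = {1..n} \<rightarrow>\<^sub>E {0, 1}"

text \<open>\<open>\<rho> j a x\<close> is the state sent by sender \<open>j\<close> on input \<open>(a, x)\<close>.\<close>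

definition qubit_states :: "nat \<Rightarrow> (nat \<Rightarrow> nat \<Rightarrow> nat \<Rightarrow> complex mat) \<Rightarrow> bool" where
  "qubit_states n \<rho> \<longleftrightarrow> (\<forall>j\<in>{1..n}. \<forall>a\<in>{0, 1}. \<forall>x\<in>{0, 1}. density (\<rho> j a x))"

definition povm :: "nat \<Rightarrow> ((nat \<Rightarrow> nat) \<Rightarrow> complex mat) \<Rightarrow> bool" where
  "povm n M \<longleftrightarrow> (\<forall>s\<in>bitstrings n. psd (2 ^ n) (M s)) \<and>
     mat_sum (2 ^ n) M (bitstrings n) = 1\<^sub>m (2 ^ n)"

definition obs :: "(nat \<Rightarrow> nat \<Rightarrow> nat \<Rightarrow> complex mat) \<Rightarrow> nat \<Rightarrow> nat \<Rightarrow> complex mat" where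
  "obs \<rho> j x = \<rho> j 0 x - \<rho> j 1 x"

definition W_op ::
  "nat \<Rightarrow> (nat \<Rightarrow> nat \<Rightarrow> nat \<Rightarrow> complex mat) \<Rightarrow> (nat \<Rightarrow> nat) \<Rightarrow> complex mat" where
  "W_op n \<rho> s =
     ((of_nat n - 1) * (-1) ^ s 1) \<cdot>\<^sub>m
       tensor n (\<lambda>i. if i = 1 then obs \<rho> 1 0 + obs \<rho> 1 1 else obs \<rho> i 0)
     + mat_sum (2 ^ n)
         (\<lambda>j. (-1) ^ s j \<cdot>\<^sub>m
            tensor n (\<lambda>i. if i = 1 then obs \<rho> 1 0 - obs \<rho> 1 1
                          else if i = j then obs \<rho> j 1 else 1\<^sub>m 2))
         {2..n}"

text \<open>Complex valued, because the trace is; that the value is real is part of what is to be shown.\<close>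

definition success ::
  "nat \<Rightarrow> (nat \<Rightarrow> nat \<Rightarrow> nat \<Rightarrow> complex mat) \<Rightarrow> ((nat \<Rightarrow> nat) \<Rightarrow> complex mat) \<Rightarrow> complex" where
  "success n \<rho> M = 1 / (2 ^ n * (of_nat n - 1) * 2 * complex_of_real (sqrt 2)) *
     (\<Sum>s\<in>bitstrings n. mat_trace (M s * W_op n \<rho> s))"

definition ket_plus :: "complex mat" where
  "ket_plus = ket2 (1 / complex_of_real (sqrt 2)) (1 / complex_of_real (sqrt 2))"

definition ket_minus :: "complex mat" where
  "ket_minus = ket2 (1 / complex_of_real (sqrt 2)) (- 1 / complex_of_real (sqrt 2))"

definition beta_plus :: "complex mat" where
  "beta_plus = ket2 (complex_of_real (cos (pi / 8))) (complex_of_real (sin (pi / 8)))"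

definition beta_minus :: "complex mat" where
  "beta_minus = ket2 (complex_of_real (sin (pi / 8))) (- complex_of_real (cos (pi / 8)))"

definition alpha_plus :: "complex mat" where
  "alpha_plus = ket2 (complex_of_real (sin (pi / 8))) (complex_of_real (cos (pi / 8)))"

definition alpha_minus :: "complex mat" where
  "alpha_minus = ket2 (complex_of_real (cos (pi / 8))) (- complex_of_real (sin (pi / 8)))"

definition xi :: "nat \<Rightarrow> (nat \<Rightarrow> nat) \<Rightarrow> complex mat" where
  "xi n s = (1 / complex_of_real (sqrt 2)) \<cdot>\<^sub>m
     (tensor n (\<lambda>j. if j = 1 then ket 0 else ket (s j))
      + (-1) ^ s 1 \<cdot>\<^sub>m tensor n (\<lambda>j. if j = 1 then ket 1 else ket (1 - s j)))"

end

theory Submission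
  imports Defs
begin

text \<open>Every observable \<open>\<A>\<close> is a traceless Hermitian \<open>2 \<times> 2\<close> matrix and squares to the scalar \<open>|r|\<^sup>2 \<le> 1\<close>,
  where \<open>r\<close> is its Bloch vector. So the two kinds of terms \<open>T\<close> of \<open>\<W>\<^sub>s\<close> square to scalars \<open>t\<close> as well,
  and \<open>2\<surd>2 Tr (M T) = (2 + t) Tr M - Tr (M (\<surd>2 - T)\<^sup>2)\<close>. Since
  \<open>(A\<^sub>0 + A\<^sub>1)\<^sup>2 + (A\<^sub>0 - A\<^sub>1)\<^sup>2 \<le> 4\<close>, summing over all terms and outcomes writes \<open>1 - \<S>\<close> as a sum of
  nonnegative quantities.

  If \<open>\<S> = 1\<close>, all of them vanish: every \<open>T\<close> acts as \<open>\<surd>2\<close> on the range of each effect and all Bloch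
  vectors are unit vectors, so the states are pure; the observables of every sender anticommute, hence
  are unitarily equivalent to the Pauli matrices; and each effect is stabilized by the parities
  \<open>\<plusminus> X \<otimes> \<dots> \<otimes> X\<close> and \<open>\<plusminus> Z\<^sub>1 Z\<^sub>j\<close>, whose joint eigenvectors are the orthonormal basis \<open>\<xi>\<^sub>s\<close>.\<close>

section \<open>Complex matrices and tensor products\<close>

text \<open>The weight \<open>n - 1\<close> of the first term is what lets each of the
  \<open>n - 1\<close> terms \<open>T2 s j\<close> be paired with its own copy of
  \<open>T1 s\<close>. One pair contributes at most (4 + t + u j) Tr M with t + u j \<le> 4, and the
  traces of the effects add up to \<open>2 ^ n\<close>; this accounts for the normalization.

  In the case of equality the effects may a priori have any rank, and some may vanish. The vanishing
  defect by itself yields only t + u j = 4. The separate values t = u j = 2 come from the eigenvalue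
  sqrt 2 on one nonzero effect, which suffices because these scalars do not depend on the outcome.

  Anticommutation has two origins. For sender 1 it is derived for the sum and the difference of the
  observables, whose Bloch vectors are orthogonal as soon as both observables have unit Bloch
  vectors. For every other sender it is extracted from the two orders of the product of
  \<open>T1\<close> and \<open>T2\<close> on a nonzero effect. That the effects have rank one comes
  out last, from the completeness of the basis \<xi> combined with that of the POVM.\<close>

lemma dim_mat_adjoint [simp]: "dim_row (mat_adjoint A) = dim_col A" "dim_col (mat_adjoint A) = dim_row A"
  by (simp_all add: mat_adjoint_def)

lemma mat_adjoint_carrier [simp]: "A \<in> carrier_mat m n \<Longrightarrow> mat_adjoint A \<in> carrier_mat n m"
  by (intro carrier_matI) auto

lemma index_mat_adjoint [simp]:
  fixes A :: "complex mat"
  assumes "i < dim_col A" "k < dim_row A"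
  shows "mat_adjoint A $$ (i, k) = cnj (A $$ (k, i))"
  using assms by (simp add: mat_adjoint_def mat_of_rows_index)

lemma mat_adjoint_adjoint [simp]: "mat_adjoint (mat_adjoint A) = (A :: complex mat)"
  by (rule eq_matI) auto

lemma mat_adjoint_one [simp]: "mat_adjoint (1\<^sub>m d :: complex mat) = 1\<^sub>m d"
  by (rule eq_matI) auto

lemma mat_adjoint_mult:
  fixes A B :: "complex mat"
  assumes "dim_col A = dim_row B"
  shows "mat_adjoint (A * B) = mat_adjoint B * mat_adjoint A"
  using assms by (intro eq_matI) (auto simp: scalar_prod_def mult.commute)

lemma mat_adjoint_minus:
  fixes A B :: "complex mat"
  assumes "dim_row A = dim_row B" "dim_col A = dim_col B"
  shows "mat_adjoint (A - B) = mat_adjoint A - mat_adjoint B"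
  using assms by (intro eq_matI) auto

lemma mat_adjoint_smult:
  fixes A :: "complex mat"
  shows "mat_adjoint (c \<cdot>\<^sub>m A) = cnj c \<cdot>\<^sub>m mat_adjoint A"
  by (intro eq_matI) auto

lemma mat_trace_mult_comm:
  assumes "A \<in> carrier_mat m n" "B \<in> carrier_mat n m"
  shows "mat_trace (A * B) = mat_trace (B * A)"
proof -
  have "mat_trace (A * B) = (\<Sum>i<m. \<Sum>k<n. A $$ (i, k) * B $$ (k, i))"
    using assms by (auto simp: mat_trace_def scalar_prod_def lessThan_atLeast0 intro!: sum.cong)
  also have "\<dots> = (\<Sum>k<n. \<Sum>i<m. B $$ (k, i) * A $$ (i, k))"
    by (subst sum.swap) (simp add: mult.commute)
  also have "\<dots> = mat_trace (B * A)"
    using assms by (auto simp: mat_trace_def scalar_prod_def lessThan_atLeast0 intro!: sum.cong)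
  finally show ?thesis .
qed

lemma mat_trace_add:
  "A \<in> carrier_mat d d \<Longrightarrow> B \<in> carrier_mat d d \<Longrightarrow> mat_trace (A + B) = mat_trace A + mat_trace B"
  by (auto simp: mat_trace_def sum.distrib)

lemma mat_trace_minus:
  "A \<in> carrier_mat d d \<Longrightarrow> B \<in> carrier_mat d d \<Longrightarrow> mat_trace (A - B) = mat_trace A - mat_trace B"
  by (auto simp: mat_trace_def sum_subtractf)

lemma mat_trace_smult: "A \<in> carrier_mat d d \<Longrightarrow> mat_trace (c \<cdot>\<^sub>m A) = c * mat_trace A"
  by (auto simp: mat_trace_def sum_distrib_left)

lemma mat_trace_one [simp]: "mat_trace (1\<^sub>m d) = of_nat d"
  by (simp add: mat_trace_def)

lemma mat_sum_carrier [simp]: "mat_sum d f I \<in> carrier_mat d d"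
  by (simp add: mat_sum_def)

lemma mult_mat_sum:
  assumes "A \<in> carrier_mat d d" "\<And>x. x \<in> I \<Longrightarrow> f x \<in> carrier_mat d d"
  shows "A * mat_sum d f I = mat_sum d (\<lambda>x. A * f x) I"
proof (rule eq_matI)
  fix i k assume ik: "i < dim_row (mat_sum d (\<lambda>x. A * f x) I)" "k < dim_col (mat_sum d (\<lambda>x. A * f x) I)"
  have "(A * mat_sum d f I) $$ (i, k) = (\<Sum>l<d. \<Sum>x\<in>I. A $$ (i, l) * f x $$ (l, k))"
    using assms ik by (simp add: mat_sum_def scalar_prod_def lessThan_atLeast0 sum_distrib_left)
  also have "\<dots> = (\<Sum>x\<in>I. \<Sum>l<d. A $$ (i, l) * f x $$ (l, k))"
    by (rule sum.swap)
  also have "\<dots> = (\<Sum>x\<in>I. (A * f x) $$ (i, k))"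
    using assms(1) ik by (intro sum.cong refl) (auto simp: mat_sum_def scalar_prod_def lessThan_atLeast0 dest!: assms(2))
  finally show "(A * mat_sum d f I) $$ (i, k) = mat_sum d (\<lambda>x. A * f x) I $$ (i, k)"
    using ik by (simp add: mat_sum_def)
qed (use assms in \<open>auto simp: mat_sum_def\<close>)

lemma mat_sum_mult:
  assumes "A \<in> carrier_mat d d" "\<And>x. x \<in> I \<Longrightarrow> f x \<in> carrier_mat d d"
  shows "mat_sum d f I * A = mat_sum d (\<lambda>x. f x * A) I"
proof (rule eq_matI)
  fix i k assume ik: "i < dim_row (mat_sum d (\<lambda>x. f x * A) I)" "k < dim_col (mat_sum d (\<lambda>x. f x * A) I)"
  have "(mat_sum d f I * A) $$ (i, k) = (\<Sum>l<d. \<Sum>x\<in>I. f x $$ (i, l) * A $$ (l, k))"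
    using assms ik by (simp add: mat_sum_def scalar_prod_def lessThan_atLeast0 sum_distrib_right)
  also have "\<dots> = (\<Sum>x\<in>I. \<Sum>l<d. f x $$ (i, l) * A $$ (l, k))"
    by (rule sum.swap)
  also have "\<dots> = (\<Sum>x\<in>I. (f x * A) $$ (i, k))"
    using assms(1) ik by (intro sum.cong refl) (auto simp: mat_sum_def scalar_prod_def lessThan_atLeast0 dest!: assms(2))
  finally show "(mat_sum d f I * A) $$ (i, k) = mat_sum d (\<lambda>x. f x * A) I $$ (i, k)"
    using ik by (simp add: mat_sum_def)
qed (use assms in \<open>auto simp: mat_sum_def\<close>)

lemma mat_trace_mat_sum:
  assumes "\<And>x. x \<in> I \<Longrightarrow> f x \<in> carrier_mat d d"
  shows "mat_trace (mat_sum d f I) = (\<Sum>x\<in>I. mat_trace (f x))"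
proof -
  have "(\<Sum>x\<in>I. mat_trace (f x)) = (\<Sum>x\<in>I. \<Sum>i<d. f x $$ (i, i))"
    using assms by (intro sum.cong refl) (auto simp: mat_trace_def)
  then show ?thesis
    by (simp add: mat_trace_def mat_sum_def sum.swap[of _ I])
qed

lemma mat_sum_single:
  assumes "finite I" "t \<in> I" "\<And>x. x \<in> I \<Longrightarrow> x \<noteq> t \<Longrightarrow> f x = 0\<^sub>m d d" "f t \<in> carrier_mat d d"
  shows "mat_sum d f I = f t"
proof (rule eq_matI)
  fix i k assume ik: "i < dim_row (f t)" "k < dim_col (f t)"
  have "(\<Sum>x\<in>I. f x $$ (i, k)) = (\<Sum>x\<in>I. if x = t then f t $$ (i, k) else 0)"
    using assms ik by (intro sum.cong) auto
  then show "mat_sum d f I $$ (i, k) = f t $$ (i, k)"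
    using assms ik by (simp add: mat_sum_def)
qed (use assms in \<open>auto simp: mat_sum_def\<close>)

section \<open>Kronecker products and their iteration over a list of positions\<close>

lemma kron_carrier [simp]:
  "A \<in> carrier_mat m n \<Longrightarrow> B \<in> carrier_mat k l \<Longrightarrow> kron A B \<in> carrier_mat (m * k) (n * l)"
  by (intro carrier_matI) (auto simp: kron_def)

lemma sum_lessThan_mult:
  fixes f :: "nat \<Rightarrow> 'a::comm_monoid_add"
  shows "(\<Sum>i<m * n. f i) = (\<Sum>a<m. \<Sum>b<n. f (a * n + b))"
proof -
  have "(\<Sum>i<m * n. f i) = (\<Sum>a<m. sum f {a * n..<a * n + n})"
    by (rule sum.nat_group[symmetric])
  also have "\<dots> = (\<Sum>a<m. \<Sum>b<n. f (a * n + b))"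
  proof (rule sum.cong[OF refl])
    fix a
    show "sum f {a * n..<a * n + n} = (\<Sum>b<n. f (a * n + b))"
      by (rule sum.reindex_bij_witness[of _ "\<lambda>b. a * n + b" "\<lambda>i. i - a * n"]) auto
  qed
  finally show ?thesis .
qed

lemma index_kron:
  assumes "A \<in> carrier_mat m n" "B \<in> carrier_mat k l" "i < m * k" "j < n * l"
  shows "kron A B $$ (i, j) = A $$ (i div k, j div l) * B $$ (i mod k, j mod l)"
  using assms by (auto simp: kron_def)

lemma less_multD:
  fixes i m k :: nat
  assumes "i < m * k" shows "i div k < m" "i mod k < k"
  using assms by (cases "k = 0"; simp add: less_mult_imp_div_less)+

text \<open>The mixed-product property: the summation index splits into a block index and an index
  inside the block, and the double sum factors.\<close>

lemma kron_mult:
  assumes "A \<in> carrier_mat m n" "C \<in> carrier_mat n p" "B \<in> carrier_mat k l" "D \<in> carrier_mat l q"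
  shows "kron A B * kron C D = kron (A * C) (B * D)"
proof (rule eq_matI)
  fix i j assume "i < dim_row (kron (A * C) (B * D))" "j < dim_col (kron (A * C) (B * D))"
  then have ij: "i < m * k" "j < p * q" using assms by (auto simp: kron_def)
  note ij' = less_multD[OF ij(1)] less_multD[OF ij(2)]
  have K: "kron A B \<in> carrier_mat (m * k) (n * l)" "kron C D \<in> carrier_mat (n * l) (p * q)"
    using assms by auto
  have "(kron A B * kron C D) $$ (i, j) = (\<Sum>x<n * l. kron A B $$ (i, x) * kron C D $$ (x, j))"
    using K ij by (simp add: scalar_prod_def lessThan_atLeast0)
  also have "\<dots> = (\<Sum>a<n. \<Sum>b<l. kron A B $$ (i, a * l + b) * kron C D $$ (a * l + b, j))"
    by (rule sum_lessThan_mult)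
  also have "\<dots> = (\<Sum>a<n. \<Sum>b<l. (A $$ (i div k, a) * C $$ (a, j div q)) * (B $$ (i mod k, b) * D $$ (b, j mod q)))"
  proof (intro sum.cong refl)
    fix a b assume ab: "a \<in> {..<n}" "b \<in> {..<l}"
    have "a * l + b < Suc a * l" using ab by simp
    also have "\<dots> \<le> n * l" using ab by (intro mult_right_mono) auto
    finally show "kron A B $$ (i, a * l + b) * kron C D $$ (a * l + b, j)
      = (A $$ (i div k, a) * C $$ (a, j div q)) * (B $$ (i mod k, b) * D $$ (b, j mod q))"
      using ab ij by (simp add: index_kron[OF assms(1,3)] index_kron[OF assms(2,4)])
  qed
  also have "\<dots> = (A * C) $$ (i div k, j div q) * (B * D) $$ (i mod k, j mod q)"
    using assms ij' by (simp add: scalar_prod_def lessThan_atLeast0 sum_product)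
  also have "\<dots> = kron (A * C) (B * D) $$ (i, j)"
    using assms ij by (subst index_kron[of _ m p _ k q]) auto
  finally show "(kron A B * kron C D) $$ (i, j) = kron (A * C) (B * D) $$ (i, j)" .
qed (use assms in \<open>auto simp: kron_def\<close>)

lemma kron_adjoint: "mat_adjoint (kron A B) = kron (mat_adjoint A) (mat_adjoint B)"
  by (rule eq_matI) (auto simp: kron_def less_multD)

lemma kron_smult: "kron (c \<cdot>\<^sub>m A) (d \<cdot>\<^sub>m B) = (c * d) \<cdot>\<^sub>m kron A B"
  by (rule eq_matI) (auto simp: kron_def less_multD)

lemma kron_one: "kron (1\<^sub>m m) (1\<^sub>m n) = (1\<^sub>m (m * n) :: complex mat)"
proof (rule eq_matI)
  fix i j assume ij: "i < dim_row (1\<^sub>m (m * n) :: complex mat)" "j < dim_col (1\<^sub>m (m * n) :: complex mat)"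
  have "i div n = j div n \<and> i mod n = j mod n \<longleftrightarrow> i = j"
    by (metis div_mult_mod_eq)
  then show "kron (1\<^sub>m m) (1\<^sub>m n) $$ (i, j) = (1\<^sub>m (m * n) :: complex mat) $$ (i, j)"
    using ij by (auto simp: kron_def less_multD)
qed (auto simp: kron_def)

lemma kron_add_left:
  assumes "A \<in> carrier_mat m n" "A' \<in> carrier_mat m n"
  shows "kron (A + A') B = kron A B + kron A' B"
  using assms by (intro eq_matI) (auto simp: kron_def less_multD ring_distribs)

lemma kron_add_right:
  assumes "B \<in> carrier_mat m n" "B' \<in> carrier_mat m n"
  shows "kron A (B + B') = kron A B + kron A B'"
  using assms by (intro eq_matI) (auto simp: kron_def less_multD ring_distribs)

text \<open>Generalizes \<open>tensor\<close> from the positions \<open>1, ..., n\<close> to an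
  arbitrary list, so that the laws of the tensor product can be proved by induction on the
  list.\<close>

definition tensor_on :: "nat list \<Rightarrow> (nat \<Rightarrow> complex mat) \<Rightarrow> complex mat" where
  "tensor_on js A = foldr kron (map A js) (1\<^sub>m 1)"

lemma tensor_on_simps [simp]:
  "tensor_on [] A = 1\<^sub>m 1" "tensor_on (j # js) A = kron (A j) (tensor_on js A)"
  by (simp_all add: tensor_on_def)

lemma tensor_on_carrier:
  "(\<And>j. j \<in> set js \<Longrightarrow> A j \<in> carrier_mat m n) \<Longrightarrow> tensor_on js A \<in> carrier_mat (m ^ length js) (n ^ length js)"
  by (induction js) auto

lemma tensor_on_mult:
  assumes "\<And>j. j \<in> set js \<Longrightarrow> A j \<in> carrier_mat m n" "\<And>j. j \<in> set js \<Longrightarrow> B j \<in> carrier_mat n p"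
  shows "tensor_on js A * tensor_on js B = tensor_on js (\<lambda>j. A j * B j)"
  using assms
proof (induction js)
  case (Cons j js)
  then show ?case
    by (simp add: kron_mult[OF _ _ tensor_on_carrier tensor_on_carrier, of _ m n _ p _ _ m n _ p])
qed simp

lemma tensor_on_adjoint: "mat_adjoint (tensor_on js A) = tensor_on js (\<lambda>j. mat_adjoint (A j))"
  by (induction js) (simp_all add: kron_adjoint)

lemma tensor_on_smult: "tensor_on js (\<lambda>j. c j \<cdot>\<^sub>m A j) = prod_list (map c js) \<cdot>\<^sub>m tensor_on js A"
  by (induction js) (auto simp: kron_smult)

lemma tensor_on_one: "tensor_on js (\<lambda>j. 1\<^sub>m d) = 1\<^sub>m (d ^ length js)"
  by (induction js) (simp_all add: kron_one)

lemma tensor_on_cong: "(\<And>j. j \<in> set js \<Longrightarrow> A j = B j) \<Longrightarrow> tensor_on js A = tensor_on js B"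
  by (induction js) auto

text \<open>Additivity in the slot \<open>k\<close>. Since \<open>js\<close> is distinct, the tail
  behind \<open>k\<close> does not see the update, so bilinearity of \<open>kron\<close> is applied
  once at \<open>k\<close> and propagated through the other positions.\<close>

lemma tensor_on_add:
  assumes "distinct js" "k \<in> set js" "\<And>j. j \<in> set js \<Longrightarrow> A j \<in> carrier_mat m n"
    and "B \<in> carrier_mat m n" "C \<in> carrier_mat m n"
  shows "tensor_on js (A(k := B + C)) = tensor_on js (A(k := B)) + tensor_on js (A(k := C))"
  using assms
proof (induction js)
  case (Cons j js)
  show ?case
  proof (cases "j = k")
    case True
    then have "tensor_on js (A(k := X)) = tensor_on js A" for X
      using Cons.prems by (intro tensor_on_cong) auto
    then show ?thesis using True Cons.prems by (simp add: kron_add_left del: fun_upd_apply) (simp add: kron_add_left)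
  next
    case False
    have c: "tensor_on js (A(k := X)) \<in> carrier_mat (m ^ length js) (n ^ length js)"
      if "X \<in> carrier_mat m n" for X
      using Cons.prems that by (intro tensor_on_carrier) auto
    show ?thesis
      using False Cons kron_add_right[OF c[of B] c[of C]] by (simp del: fun_upd_apply) simp
  qed
qed simp

lemma tensor_eq_tensor_on: "tensor n A = tensor_on [1..<Suc n] A"
  by (simp add: tensor_def tensor_on_def)

lemma tensor_carrier:
  "(\<And>j. j \<in> {1..n} \<Longrightarrow> A j \<in> carrier_mat a b) \<Longrightarrow> tensor n A \<in> carrier_mat (a ^ n) (b ^ n)"
  unfolding tensor_eq_tensor_on using tensor_on_carrier[of "[1..<Suc n]" A a b] by (auto simp del: upt_Suc)

lemma tensor_mult:
  assumes "\<And>j. j \<in> {1..n} \<Longrightarrow> A j \<in> carrier_mat a b" "\<And>j. j \<in> {1..n} \<Longrightarrow> B j \<in> carrier_mat b c"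
  shows "tensor n A * tensor n B = tensor n (\<lambda>j. A j * B j)"
  unfolding tensor_eq_tensor_on using assms by (intro tensor_on_mult[of _ _ a b _ c]) (auto simp del: upt_Suc)

lemma tensor_adjoint: "mat_adjoint (tensor n A) = tensor n (\<lambda>j. mat_adjoint (A j))"
  by (simp only: tensor_eq_tensor_on tensor_on_adjoint)

lemma tensor_smult: "tensor n (\<lambda>j. c j \<cdot>\<^sub>m A j) = (\<Prod>j\<in>{1..n}. c j) \<cdot>\<^sub>m tensor n A"
  using prod.distinct_set_conv_list[OF distinct_upt, of c 1 "Suc n"]
  by (simp add: tensor_eq_tensor_on tensor_on_smult atLeastLessThanSuc_atLeastAtMost del: upt_Suc)

lemma tensor_one: "tensor n (\<lambda>j. 1\<^sub>m d) = 1\<^sub>m (d ^ n)"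
  by (simp add: tensor_eq_tensor_on tensor_on_one del: upt_Suc)

lemma tensor_cong: "(\<And>j. j \<in> {1..n} \<Longrightarrow> A j = B j) \<Longrightarrow> tensor n A = tensor n B"
  unfolding tensor_eq_tensor_on by (rule tensor_on_cong) (auto simp del: upt_Suc)

lemma tensor_add:
  assumes "k \<in> {1..n}" "\<And>j. j \<in> {1..n} \<Longrightarrow> A j \<in> carrier_mat a b"
    and "B \<in> carrier_mat a b" "C \<in> carrier_mat a b"
  shows "tensor n (A(k := B + C)) = tensor n (A(k := B)) + tensor n (A(k := C))"
  unfolding tensor_eq_tensor_on using assms by (intro tensor_on_add) (auto simp del: upt_Suc)

section \<open>Positive semidefinite matrices and the sum-of-squares identity\<close>

lemma psdD:
  assumes "psd d M"
  shows "M \<in> carrier_mat d d" "mat_adjoint M = M"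
    "\<And>v. v \<in> carrier_vec d \<Longrightarrow> 0 \<le> (M *\<^sub>v v) \<bullet>c v"
  using assms by (auto simp: psd_def)

lemma cscalar_prod_mat_adjoint:
  fixes A :: "complex mat"
  assumes "A \<in> carrier_mat m n" "v \<in> carrier_vec n" "w \<in> carrier_vec m"
  shows "(A *\<^sub>v v) \<bullet>c w = v \<bullet>c (mat_adjoint A *\<^sub>v w)"
proof -
  have "(A *\<^sub>v v) \<bullet>c w = (\<Sum>i<m. \<Sum>k<n. A $$ (i, k) * v $ k * cnj (w $ i))"
    using assms by (auto simp: scalar_prod_def lessThan_atLeast0 sum_distrib_right intro!: sum.cong)
  also have "\<dots> = (\<Sum>k<n. \<Sum>i<m. A $$ (i, k) * v $ k * cnj (w $ i))"
    by (rule sum.swap)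
  also have "\<dots> = v \<bullet>c (mat_adjoint A *\<^sub>v w)"
    using assms by (auto simp: scalar_prod_def lessThan_atLeast0 sum_distrib_left mult_ac intro!: sum.cong)
  finally show ?thesis .
qed

text \<open>The quadratic form is nonnegative at \<open>v - e M v\<close> for every real \<open>e\<close>; small \<open>e > 0\<close> forces
  \<open>M v = 0\<close>.\<close>

lemma psd_mult_vec_eq_0:
  assumes M: "psd d M" and v: "v \<in> carrier_vec d" and 0: "(M *\<^sub>v v) \<bullet>c v = 0"
  shows "M *\<^sub>v v = 0\<^sub>v d"
proof -
  note MC = psdD(1)[OF M]
  define w where "w = M *\<^sub>v v"
  have w: "w \<in> carrier_vec d" and Mw: "M *\<^sub>v w \<in> carrier_vec d" using MC v by (auto simp: w_def)
  define a where "a = w \<bullet>c w"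
  define b where "b = (M *\<^sub>v w) \<bullet>c w"
  have a: "a \<ge> 0" unfolding a_def by auto
  have b: "b \<ge> 0" unfolding b_def by (rule psdD(3)[OF M w])
  have Mwv: "(M *\<^sub>v w) \<bullet>c v = a"
    using cscalar_prod_mat_adjoint[OF MC w v] psdD(2)[OF M] by (simp add: a_def w_def)
  have q: "0 \<le> - 2 * of_real e * a + of_real (e\<^sup>2) * b" for e :: real
  proof -
    let ?u = "v + (- of_real e) \<cdot>\<^sub>v w"
    have u: "?u \<in> carrier_vec d" using v w by auto
    have Mu: "M *\<^sub>v ?u = w + (- of_real e) \<cdot>\<^sub>v (M *\<^sub>v w)"
      using MC v w by (simp add: mult_add_distrib_mat_vec mult_mat_vec w_def)
    have c: "conjugate ?u = conjugate v + (- of_real e) \<cdot>\<^sub>v conjugate w"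
      using v w by (intro eq_vecI) auto
    have "(M *\<^sub>v ?u) \<bullet>c ?u = w \<bullet>c v + (- of_real e) * (w \<bullet>c w) + (- of_real e) * ((M *\<^sub>v w) \<bullet>c v)
       + (- of_real e) * (- of_real e) * ((M *\<^sub>v w) \<bullet>c w)"
      unfolding Mu c using w v Mw
      by (simp add: add_scalar_prod_distrib[where n = d] scalar_prod_add_distrib[where n = d] algebra_simps)
    also have "\<dots> = - 2 * of_real e * a + of_real (e\<^sup>2) * b"
      using 0 by (simp add: Mwv flip: a_def b_def w_def) (simp add: power2_eq_square)
    finally show ?thesis using psdD(3)[OF M u] by simp
  qed
  have ab: "a = of_real (Re a)" "b = of_real (Re b)" using a b by (auto simp: less_eq_complex_def complex_eq_iff)
  have q': "0 \<le> - 2 * e * Re a + e\<^sup>2 * Re b" for e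
  proof -
    have "- 2 * of_real e * a + of_real (e\<^sup>2) * b = of_real (- 2 * e * Re a + e\<^sup>2 * Re b)"
      by (subst ab(1), subst ab(2)) simp
    then show ?thesis using q[of e] by (simp only: less_eq_complex_def) simp
  qed
  have rb: "Re b \<ge> 0" and ra: "Re a \<ge> 0" using a b by (auto simp: less_eq_complex_def)
  have "Re a = 0"
  proof (rule ccontr)
    assume "Re a \<noteq> 0"
    then have ra: "Re a > 0" using ra by simp
    \<comment> \<open>The parabola has its minimum at \<open>Re a / Re b\<close>; adding 1 to the
      denominator avoids the case \<open>Re b = 0\<close> and still gives a negative value.\<close>
    let ?f = "Re a / (Re b + 1)"
    have "0 \<le> (- 2 * ?f * Re a + ?f\<^sup>2 * Re b) * (Re b + 1)\<^sup>2"
      using q'[of ?f] by (intro mult_nonneg_nonneg) auto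
    also have "\<dots> = (Re a)\<^sup>2 * (- Re b - 2)"
      using rb by (simp add: power2_eq_square divide_simps) (simp add: algebra_simps)
    also have "\<dots> < 0" using ra rb by (intro mult_pos_neg) auto
    finally show False by simp
  qed
  then have "w \<bullet>c w = 0" using ab(1) by (simp add: a_def)
  then show ?thesis using w by (simp add: w_def)
qed

text \<open>By cyclicity this is the trace of L* M L, whose diagonal entries are the quadratic form
  of \<open>M\<close> at the columns of \<open>L\<close>. It reduces statements about traces to the
  definition of \<open>psd\<close>.\<close>

lemma mat_trace_mult_adjoint:
  fixes M L :: "complex mat"
  assumes "M \<in> carrier_mat d d" "L \<in> carrier_mat d d"
  shows "mat_trace (M * (L * mat_adjoint L)) = (\<Sum>i<d. (M *\<^sub>v col L i) \<bullet>c col L i)"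
proof -
  have "mat_trace (M * (L * mat_adjoint L)) = mat_trace (M * L * mat_adjoint L)"
    using assms by (simp add: assoc_mult_mat[of _ d d _ d _ d])
  also have "\<dots> = mat_trace (mat_adjoint L * (M * L))"
    using assms by (intro mat_trace_mult_comm[of _ d d]) auto
  also have "\<dots> = (\<Sum>i<d. (M *\<^sub>v col L i) \<bullet>c col L i)"
  proof -
    have r: "row (mat_adjoint L) i = conjugate (col L i)" if "i < d" for i
      using assms that by (intro eq_vecI) auto
    have c: "col (M * L) i = M *\<^sub>v col L i" if "i < d" for i
      using assms that by (intro eq_vecI) auto
    have "(mat_adjoint L * (M * L)) $$ (i, i) = (M *\<^sub>v col L i) \<bullet>c col L i" if "i < d" for i
    proof -
      have "(mat_adjoint L * (M * L)) $$ (i, i) = row (mat_adjoint L) i \<bullet> col (M * L) i"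
        using assms that by (intro index_mult_mat(1)) auto
      also have "\<dots> = conjugate (col L i) \<bullet> (M *\<^sub>v col L i)"
        unfolding r[OF that] c[OF that] ..
      also have "\<dots> = (M *\<^sub>v col L i) \<bullet>c col L i"
        using assms that by (intro comm_scalar_prod[of _ d]) auto
      finally show ?thesis .
    qed
    then show ?thesis using assms by (auto simp: mat_trace_def)
  qed
  finally show ?thesis .
qed

lemma psd_trace_mult_adjoint_nonneg:
  assumes "psd d M" "L \<in> carrier_mat d d"
  shows "0 \<le> mat_trace (M * (L * mat_adjoint L))"
  unfolding mat_trace_mult_adjoint[OF psdD(1)[OF assms(1)] assms(2)]
  using assms by (intro sum_nonneg psdD(3)) auto

text \<open>The trace is a sum of nonnegative values of the quadratic form, one for each column of
  \<open>L\<close>; all of them vanish, so \<open>M\<close> annihilates each column.\<close>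

lemma psd_trace_mult_adjoint_eq_0:
  assumes M: "psd d M" and L: "L \<in> carrier_mat d d" and 0: "mat_trace (M * (L * mat_adjoint L)) = 0"
  shows "M * L = 0\<^sub>m d d"
proof -
  have "(M *\<^sub>v col L i) \<bullet>c col L i = 0" if "i < d" for i
    using 0 L that unfolding mat_trace_mult_adjoint[OF psdD(1)[OF M] L]
    by (subst (asm) sum_nonneg_eq_0_iff) (auto intro!: psdD(3)[OF M])
  then have *: "M *\<^sub>v col L i = 0\<^sub>v d" if "i < d" for i
    using that L by (intro psd_mult_vec_eq_0[OF M]) auto
  show ?thesis
  proof (rule eq_matI)
    fix i k assume "i < dim_row (0\<^sub>m d d :: complex mat)" "k < dim_col (0\<^sub>m d d :: complex mat)"
    then show "(M * L) $$ (i, k) = 0\<^sub>m d d $$ (i, k)"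
      using psdD(1)[OF M] L arg_cong[OF *[of k], of "\<lambda>v. v $ i"] by simp
  qed (use psdD(1)[OF M] L in auto)
qed

lemma proj_carrier [simp]: "\<psi> \<in> carrier_mat d k \<Longrightarrow> proj \<psi> \<in> carrier_mat d d"
  unfolding proj_def by (rule mult_carrier_mat) auto

lemma psd_proj:
  assumes "\<psi> \<in> carrier_mat d k"
  shows "psd d (proj \<psi>)"
  unfolding psd_def
proof (intro conjI ballI)
  show "mat_adjoint (proj \<psi>) = proj \<psi>"
    using assms by (simp add: proj_def mat_adjoint_mult)
  fix v :: "complex vec" assume v: "v \<in> carrier_vec d"
  have "(proj \<psi> *\<^sub>v v) \<bullet>c v = (\<psi> *\<^sub>v (mat_adjoint \<psi> *\<^sub>v v)) \<bullet>c v"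
    unfolding proj_def using assms v by (subst assoc_mult_mat_vec[of _ d k _ d]) auto
  also have "\<dots> = (mat_adjoint \<psi> *\<^sub>v v) \<bullet>c (mat_adjoint \<psi> *\<^sub>v v)"
    using assms v by (intro cscalar_prod_mat_adjoint) (auto intro!: mult_mat_vec_carrier[of _ _ d])
  finally show "0 \<le> (proj \<psi> *\<^sub>v v) \<bullet>c v" by auto
qed (use assms in auto)

text \<open>If \<open>T\<^sup>2 = t\<close> and \<open>L = \<surd>2 - T\<close> then \<open>2\<surd>2 T = (2 + t) - L\<^sup>2\<close>; this is the sum-of-squares certificate for
  the bound on the success metric.\<close>

definition sos :: "nat \<Rightarrow> complex mat \<Rightarrow> complex mat" where
  "sos d T = complex_of_real (sqrt 2) \<cdot>\<^sub>m 1\<^sub>m d - T"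

lemma sos_carrier [simp]: "T \<in> carrier_mat d d \<Longrightarrow> sos d T \<in> carrier_mat d d"
  by (simp add: sos_def minus_carrier_mat)

lemma sos_adjoint: "T \<in> carrier_mat d d \<Longrightarrow> mat_adjoint T = T \<Longrightarrow> mat_adjoint (sos d T) = sos d T"
  by (simp add: sos_def mat_adjoint_minus mat_adjoint_smult)

lemma sos_mult:
  assumes "T \<in> carrier_mat d d" "M \<in> carrier_mat d d"
  shows "sos d T * M = complex_of_real (sqrt 2) \<cdot>\<^sub>m M - T * M"
  using assms mult_smult_assoc_mat[of "1\<^sub>m d" d d M d "complex_of_real (sqrt 2)"]
  by (simp add: sos_def minus_mult_distrib_mat[of _ d d _ _ d])

lemma sqrt2_mult: "complex_of_real (sqrt 2) * complex_of_real (sqrt 2) = 2"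
  "complex_of_real (sqrt 2) * (complex_of_real (sqrt 2) * x) = 2 * x"
  by (simp_all flip: of_real_mult mult.assoc)

lemma sos_square:
  assumes "T \<in> carrier_mat d d" "T * T = t \<cdot>\<^sub>m 1\<^sub>m d"
  shows "sos d T * sos d T = (2 + t) \<cdot>\<^sub>m 1\<^sub>m d - (2 * complex_of_real (sqrt 2)) \<cdot>\<^sub>m T"
proof -
  let ?r = "complex_of_real (sqrt 2)"
  have "sos d T * sos d T = (?r \<cdot>\<^sub>m 1\<^sub>m d) * sos d T - T * sos d T"
    unfolding sos_def[of d T] using assms(1) by (intro minus_mult_distrib_mat[of _ d d _ _ d]) auto
  also have "\<dots> = ?r \<cdot>\<^sub>m sos d T - (?r \<cdot>\<^sub>m T - T * T)"
    using assms(1) mult_smult_assoc_mat[of "1\<^sub>m d" d d "sos d T" d ?r]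
    by (simp add: sos_def minus_carrier_mat mult_minus_distrib_mat[of _ d d _ d] mult_smult_distrib[of _ d d _ d])
  also have "\<dots> = (2 + t) \<cdot>\<^sub>m 1\<^sub>m d - (2 * ?r) \<cdot>\<^sub>m T"
    unfolding assms(2) using assms(1) sqrt2_mult
    by (intro eq_matI) (auto simp: sos_def algebra_simps)
  finally show ?thesis .
qed

text \<open>The scalar \<open>t\<close> stays a parameter because Bloch vectors shorter than 1 must
  be covered too.\<close>

lemma mat_trace_sos:
  assumes "M \<in> carrier_mat d d" "T \<in> carrier_mat d d" "T * T = t \<cdot>\<^sub>m 1\<^sub>m d"
  shows "2 * complex_of_real (sqrt 2) * mat_trace (M * T) =
    (2 + t) * mat_trace M - mat_trace (M * (sos d T * sos d T))"
proof -
  have "M * (sos d T * sos d T) = (2 + t) \<cdot>\<^sub>m M - (2 * complex_of_real (sqrt 2)) \<cdot>\<^sub>m (M * T)"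
    unfolding sos_square[OF assms(2,3)] using assms(1,2)
    by (simp add: mult_minus_distrib_mat[of _ d d _ d] mult_smult_distrib[of _ d d _ d])
  then show ?thesis using assms(1,2)
    by (simp add: mat_trace_minus[of _ d] mat_trace_smult[of _ d])
qed

lemma mat_trace_sos_nonneg:
  assumes "psd d M" "T \<in> carrier_mat d d" "mat_adjoint T = T"
  shows "0 \<le> mat_trace (M * (sos d T * sos d T))"
  using psd_trace_mult_adjoint_nonneg[OF assms(1) sos_carrier[OF assms(2)]] sos_adjoint[OF assms(2,3)]
  by simp

text \<open>A vanishing trace gives \<open>M * sos d T = 0\<close>; taking adjoints moves the
  Hermitian factor to the left, where the equation says that \<open>T\<close> acts as sqrt 2 on the
  range of \<open>M\<close>. The forward direction analyses optimal strategies, the converse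
  verifies the ideal one.\<close>

lemma mat_trace_sos_eq_0_iff:
  assumes M: "psd d M" and T: "T \<in> carrier_mat d d" "mat_adjoint T = T"
  shows "mat_trace (M * (sos d T * sos d T)) = 0 \<longleftrightarrow> T * M = complex_of_real (sqrt 2) \<cdot>\<^sub>m M"
proof
  note MC = psdD(1)[OF M]
  assume "mat_trace (M * (sos d T * sos d T)) = 0"
  then have "M * sos d T = 0\<^sub>m d d"
    using sos_adjoint[OF T] by (intro psd_trace_mult_adjoint_eq_0[OF M sos_carrier[OF T(1)]]) simp
  from arg_cong[OF this, of mat_adjoint] have "sos d T * M = 0\<^sub>m d d"
    using T MC psdD(2)[OF M] mat_adjoint_mult[of M "sos d T"] sos_carrier[OF T(1)]
    by (auto simp: sos_adjoint)
  then have "complex_of_real (sqrt 2) \<cdot>\<^sub>m M - T * M = 0\<^sub>m d d"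
    using sos_mult[OF T(1) MC] by simp
  then have e: "(complex_of_real (sqrt 2) \<cdot>\<^sub>m M - T * M) $$ (i, k) = 0" if "i < d" "k < d" for i k
    using that by simp
  show "T * M = complex_of_real (sqrt 2) \<cdot>\<^sub>m M"
    using e T(1) MC by (intro eq_matI) auto
next
  note MC = psdD(1)[OF M]
  assume *: "T * M = complex_of_real (sqrt 2) \<cdot>\<^sub>m M"
  have "sos d T * M = complex_of_real (sqrt 2) \<cdot>\<^sub>m M - T * M"
    by (rule sos_mult[OF T(1) MC])
  then have z: "sos d T * M = 0\<^sub>m d d" using MC by (simp add: *)
  have "mat_trace (M * (sos d T * sos d T)) = mat_trace (sos d T * (sos d T * M))"
    using T(1) MC by (subst mat_trace_mult_comm[of _ d d]) (auto simp: assoc_mult_mat[of _ d d _ d _ d] intro!: mult_carrier_mat[of _ d d])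
  then show "mat_trace (M * (sos d T * sos d T)) = 0"
    unfolding z right_mult_zero_mat[OF sos_carrier[OF T(1)]] by (simp add: mat_trace_def)
qed

section \<open>Qubit observables\<close>

definition mat2 :: "complex \<Rightarrow> complex \<Rightarrow> complex \<Rightarrow> complex \<Rightarrow> complex mat" where
  "mat2 a b c d = mat 2 2 (\<lambda>(i, k). if i = 0 then if k = 0 then a else b else if k = 0 then c else d)"

lemma mat2_carrier [simp]: "mat2 a b c d \<in> carrier_mat 2 2"
  and mat2_dim [simp]: "dim_row (mat2 a b c d) = 2" "dim_col (mat2 a b c d) = 2"
  by (simp_all add: mat2_def)

lemma mat2_index [simp]:
  "mat2 a b c d $$ (0, 0) = a" "mat2 a b c d $$ (0, 1) = b"
  "mat2 a b c d $$ (1, 0) = c" "mat2 a b c d $$ (1, 1) = d"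
  "mat2 a b c d $$ (0, Suc 0) = b" "mat2 a b c d $$ (Suc 0, 0) = c" "mat2 a b c d $$ (Suc 0, Suc 0) = d"
  by (simp_all add: mat2_def)

lemma eq_mat2I:
  assumes "A \<in> carrier_mat 2 2" "A $$ (0, 0) = a" "A $$ (0, 1) = b" "A $$ (1, 0) = c" "A $$ (1, 1) = d"
  shows "A = mat2 a b c d"
  using assms by (intro eq_matI) (auto simp: less_2_cases_iff)

lemma mat2_inject [simp]: "mat2 a b c d = mat2 a' b' c' d' \<longleftrightarrow> a = a' \<and> b = b' \<and> c = c' \<and> d = d'"
  by (metis mat2_index(1-4))

lemma mat2_mult [simp]:
  "mat2 a b c d * mat2 a' b' c' d' = mat2 (a * a' + b * c') (a * b' + b * d') (c * a' + d * c') (c * b' + d * d')"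
proof (rule eq_mat2I)
  show "mat2 a b c d * mat2 a' b' c' d' \<in> carrier_mat 2 2" by (rule mult_carrier_mat) auto
qed (simp_all add: scalar_prod_def atLeast0_lessThan_Suc eval_nat_numeral)

lemma mat2_add [simp]: "mat2 a b c d + mat2 a' b' c' d' = mat2 (a + a') (b + b') (c + c') (d + d')"
  and mat2_minus [simp]: "mat2 a b c d - mat2 a' b' c' d' = mat2 (a - a') (b - b') (c - c') (d - d')"
  and mat2_smult [simp]: "x \<cdot>\<^sub>m mat2 a b c d = mat2 (x * a) (x * b) (x * c) (x * d)"
  and mat2_adjoint [simp]: "mat_adjoint (mat2 a b c d) = mat2 (cnj a) (cnj c) (cnj b) (cnj d)"
  and one_mat2: "1\<^sub>m 2 = mat2 1 0 0 1"
  by (rule eq_mat2I; simp add: minus_carrier_mat)+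

lemma mat2_trace [simp]: "mat_trace (mat2 a b c d) = a + d"
  by (simp add: mat_trace_def numeral_2_eq_2)

lemma mat2_cases:
  assumes "A \<in> carrier_mat 2 2"
  obtains a b c d where "A = mat2 a b c d"
  using eq_mat2I[OF assms] by blast

lemma mat2_psd_form:
  "(mat2 a b c d *\<^sub>v vec_of_list [x, y]) \<bullet>c vec_of_list [x, y]
    = (a * x + b * y) * cnj x + (c * x + d * y) * cnj y"
  by (simp add: scalar_prod_def mult_mat_vec_def row_def mat2_def numeral_2_eq_2 flip: vec_of_list_index)

lemma density_mat2E:
  assumes "density \<rho>"
  obtains p z where "\<rho> = mat2 (of_real p) z (cnj z) (of_real (1 - p))" "(cmod z)\<^sup>2 \<le> p * (1 - p)"
proof -
  from assms have \<rho>: "psd 2 \<rho>" "mat_trace \<rho> = 1" by (auto simp: density_def)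
  obtain a z c d where A: "\<rho> = mat2 a z c d" using psdD(1)[OF \<rho>(1)] by (rule mat2_cases)
  from psdD(2)[OF \<rho>(1)] \<rho>(2) have h: "cnj a = a" "c = cnj z" "d = 1 - a"
    by (auto simp: A algebra_simps)
  define p where "p = Re a"
  have a: "a = of_real p" using h(1) by (simp add: p_def complex_eq_iff)
  have M: "\<rho> = mat2 (of_real p) z (cnj z) (of_real (1 - p))" by (simp add: A a h)
  have pos: "0 \<le> (of_real p * x + z * y) * cnj x + (cnj z * x + of_real (1 - p) * y) * cnj y" for x y
  proof -
    have "vec_of_list [x, y] \<in> carrier_vec 2" by (rule carrier_vecI) simp
    from psdD(3)[OF \<rho>(1) this] show ?thesis unfolding M mat2_psd_form .
  qed
  \<comment> \<open>\<open>?D\<close> is the determinant. The form is evaluated at the two columns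
    of the adjugate, (-z, p) and (1 - p, -cnj z), which the matrix maps to \<open>?D\<close> times a
    unit vector. This gives the values p \<open>?D\<close> and (1 - p) \<open>?D\<close>, whose sum
    is \<open>?D\<close>, without a case distinction on vanishing diagonal entries.\<close>
  let ?D = "p * (1 - p) - (cmod z)\<^sup>2"
  have D: "complex_of_real ?D = of_real p * (1 - of_real p) - z * cnj z"
    unfolding of_real_diff complex_norm_square by simp
  have "complex_of_real (p * ?D) = (of_real p * (- z) + z * of_real p) * cnj (- z)
      + (cnj z * (- z) + of_real (1 - p) * of_real p) * cnj (of_real p)"
    unfolding of_real_mult[of p ?D] D by (simp add: algebra_simps)
  then have "0 \<le> complex_of_real (p * ?D)" using pos[of "- z" "of_real p"] by (simp only:)
  moreover have "complex_of_real ((1 - p) * ?D) = (of_real p * of_real (1 - p) + z * (- cnj z)) * cnj (of_real (1 - p))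
      + (cnj z * of_real (1 - p) + of_real (1 - p) * (- cnj z)) * cnj (- cnj z)"
    unfolding of_real_mult[of "1 - p" ?D] D by (simp add: algebra_simps)
  then have "0 \<le> complex_of_real ((1 - p) * ?D)" using pos[of "of_real (1 - p)" "- cnj z"] by (simp only:)
  ultimately have "0 \<le> p * ?D + (1 - p) * ?D" by (simp add: less_eq_complex_def)
  then have "(cmod z)\<^sup>2 \<le> p * (1 - p)" by (simp add: algebra_simps)
  with M show ?thesis by (rule that)
qed

text \<open>The Bloch vector is \<open>(Re b, - Im b, a)\<close>; in particular \<open>X\<close> is \<open>pauli 0 1\<close> and \<open>Z\<close> is \<open>pauli 1 0\<close>.\<close>

definition pauli :: "real \<Rightarrow> complex \<Rightarrow> complex mat" where
  "pauli a b = mat2 (of_real a) b (cnj b) (- of_real a)"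

lemma pauli_carrier [simp]: "pauli a b \<in> carrier_mat 2 2"
  and pauli_adjoint [simp]: "mat_adjoint (pauli a b) = pauli a b"
  and pauli_add: "pauli a b + pauli a' b' = pauli (a + a') (b + b')"
  and pauli_minus: "pauli a b - pauli a' b' = pauli (a - a') (b - b')"
  and pauli_smult: "of_real x \<cdot>\<^sub>m pauli a b = pauli (x * a) (of_real x * b)"
  by (simp_all add: pauli_def)

lemma of_real_bloch_norm: "complex_of_real (a\<^sup>2 + (cmod b)\<^sup>2) = of_real a * of_real a + b * cnj b"
  unfolding of_real_add complex_norm_square by (simp add: power2_eq_square)

lemma pauli_square: "pauli a b * pauli a b = of_real (a\<^sup>2 + (cmod b)\<^sup>2) \<cdot>\<^sub>m 1\<^sub>m 2"
  unfolding of_real_bloch_norm by (simp add: pauli_def one_mat2 mult.commute add.commute)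

text \<open>The Euclidean inner product of the two Bloch vectors.\<close>

definition pauli_dot :: "real \<Rightarrow> complex \<Rightarrow> real \<Rightarrow> complex \<Rightarrow> real" where
  "pauli_dot a b a' b' = a * a' + Re b * Re b' + Im b * Im b'"

lemma pauli_anticomm:
  "pauli a b * pauli a' b' + pauli a' b' * pauli a b = of_real (2 * pauli_dot a b a' b') \<cdot>\<^sub>m 1\<^sub>m 2"
  by (simp add: pauli_def one_mat2 pauli_dot_def complex_eq_iff algebra_simps)

text \<open>The pair (p0 - p1, z0 - z1) encodes half the difference of the Bloch vectors of the two
  states. If it has length 1, half their sum must be 0, so the two states are antipodal and
  pure.\<close>

lemma obs_pauli:
  assumes "density \<rho>0" "density \<rho>1"
  obtains a b where "\<rho>0 - \<rho>1 = pauli a b" "a\<^sup>2 + (cmod b)\<^sup>2 \<le> 1"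
    "a\<^sup>2 + (cmod b)\<^sup>2 = 1 \<Longrightarrow> \<rho>0 = (1 / 2) \<cdot>\<^sub>m (1\<^sub>m 2 + pauli a b) \<and> \<rho>1 = (1 / 2) \<cdot>\<^sub>m (1\<^sub>m 2 - pauli a b)"
proof -
  obtain p0 z0 where 0: "\<rho>0 = mat2 (of_real p0) z0 (cnj z0) (of_real (1 - p0))" "(cmod z0)\<^sup>2 \<le> p0 * (1 - p0)"
    using assms(1) by (rule density_mat2E)
  obtain p1 z1 where 1: "\<rho>1 = mat2 (of_real p1) z1 (cnj z1) (of_real (1 - p1))" "(cmod z1)\<^sup>2 \<le> p1 * (1 - p1)"
    using assms(2) by (rule density_mat2E)
  \<comment> \<open>The parallelogram law for the two Bloch vectors, each of length at most 1 by the
    determinant condition.\<close>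
  have par: "(p0 - p1)\<^sup>2 + (cmod (z0 - z1))\<^sup>2 + ((p0 + p1 - 1)\<^sup>2 + (cmod (z0 + z1))\<^sup>2) \<le> 1"
    using 0(2) 1(2) unfolding cmod_power2 by (simp add: power2_eq_square algebra_simps)
  show ?thesis
  proof (rule that[of "p0 - p1" "z0 - z1"])
    show "\<rho>0 - \<rho>1 = pauli (p0 - p1) (z0 - z1)" by (simp add: 0 1 pauli_def)
    show "(p0 - p1)\<^sup>2 + (cmod (z0 - z1))\<^sup>2 \<le> 1"
      by (rule order_trans[OF _ par]) simp
    assume "(p0 - p1)\<^sup>2 + (cmod (z0 - z1))\<^sup>2 = 1"
    with par have "(p0 + p1 - 1)\<^sup>2 + (cmod (z0 + z1))\<^sup>2 \<le> 0" by simp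
    then have "(p0 + p1 - 1)\<^sup>2 = 0" "(cmod (z0 + z1))\<^sup>2 = 0"
      by (smt (verit) zero_le_power2)+
    then have "p1 = 1 - p0" "z1 = - z0" by (simp_all add: eq_neg_iff_add_eq_0 add.commute)
    then show "\<rho>0 = (1 / 2) \<cdot>\<^sub>m (1\<^sub>m 2 + pauli (p0 - p1) (z0 - z1)) \<and>
        \<rho>1 = (1 / 2) \<cdot>\<^sub>m (1\<^sub>m 2 - pauli (p0 - p1) (z0 - z1))"
      by (simp add: 0 1 pauli_def one_mat2)
  qed
qed

text \<open>The matrix A = \<open>pauli c w\<close> squares to 1, so the columns of 1 + A are fixed
  by A. The first column is (1 + c, cnj w), of squared norm 2 (1 + c); it degenerates only for c =
  -1, where the second basis vector is fixed.\<close>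

lemma pauli_eigenvector:
  assumes "c\<^sup>2 + (cmod w)\<^sup>2 = 1"
  obtains \<alpha> \<beta> where "of_real c * \<alpha> + w * \<beta> = \<alpha>" "cnj w * \<alpha> - of_real c * \<beta> = \<beta>"
    "\<alpha> * cnj \<alpha> + \<beta> * cnj \<beta> = 1"
proof (cases "c = - 1")
  case True
  then show ?thesis using assms by (intro that[of 0 1]) auto
next
  case False
  have "c \<ge> - 1"
    using assms abs_square_le_1[of c] zero_le_power2[of "cmod w"] by linarith
  with False have c: "c > - 1" by simp
  define k where "k = sqrt (2 * (1 + c))"
  have k: "k > 0" "k * k = 2 * (1 + c)" using c by (auto simp: k_def)
  then have k': "complex_of_real k * of_real k = of_real (2 * (1 + c))" by (simp flip: of_real_mult)
  have w: "w * cnj w = of_real (1 - c\<^sup>2)"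
    unfolding complex_norm_square[symmetric] using assms by (intro arg_cong[of _ _ of_real]) simp
  let ?\<alpha> = "of_real (1 + c) / complex_of_real k" and ?\<beta> = "cnj w / complex_of_real k"
  show ?thesis
  proof (rule that[of ?\<alpha> ?\<beta>])
    have "of_real c * ?\<alpha> + w * ?\<beta> = (of_real (c * (1 + c)) + w * cnj w) / of_real k"
      by (simp add: add_divide_distrib distrib_left)
    also have "of_real (c * (1 + c)) + w * cnj w = complex_of_real (1 + c)"
      unfolding w of_real_add[symmetric]
      by (intro arg_cong[of _ _ of_real]) (simp add: power2_eq_square algebra_simps)
    finally show "of_real c * ?\<alpha> + w * ?\<beta> = ?\<alpha>" .
    show "cnj w * ?\<alpha> - of_real c * ?\<beta> = ?\<beta>" by (simp add: algebra_simps add_divide_distrib)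
    have "?\<alpha> * cnj ?\<alpha> + ?\<beta> * cnj ?\<beta> = (of_real ((1 + c) * (1 + c)) + w * cnj w) / (of_real k * of_real k)"
      by (simp add: add_divide_distrib[of _ _ "_ * _"] mult.commute del: of_real_add)
    also have "of_real ((1 + c) * (1 + c)) + w * cnj w = complex_of_real k * of_real k"
      unfolding w k' of_real_add[symmetric]
      by (intro arg_cong[of _ _ of_real]) (simp add: power2_eq_square algebra_simps)
    also have "of_real k * of_real k / (of_real k * of_real k) = (1 :: complex)"
      using k by simp
    finally show "?\<alpha> * cnj ?\<alpha> + ?\<beta> * cnj ?\<beta> = 1" .
  qed
qed

text \<open>Write X and Z for the two given matrices. The columns of \<open>V\<close> are a unit
  vector v with Z v = v and its image X v. Anticommutation makes X v an eigenvector of Z for -1, and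
  X swaps the columns since it squares to 1. In this basis the pair consists of the standard Pauli
  matrices.\<close>

lemma pauli_pair_unitary:
  assumes X: "a\<^sup>2 + (cmod b)\<^sup>2 = 1" and Z: "c\<^sup>2 + (cmod w)\<^sup>2 = 1" and 0: "pauli_dot a b c w = 0"
  obtains U where "unitary_mat 2 U" "conj_by U (pauli a b) = pauli 0 1" "conj_by U (pauli c w) = pauli 1 0"
proof -
  obtain \<alpha> \<beta> where v: "of_real c * \<alpha> + w * \<beta> = \<alpha>" "cnj w * \<alpha> - of_real c * \<beta> = \<beta>"
    "\<alpha> * cnj \<alpha> + \<beta> * cnj \<beta> = 1"
    using pauli_eigenvector[OF Z] .
  define \<gamma> where "\<gamma> = of_real a * \<alpha> + b * \<beta>"
  define \<delta> where "\<delta> = cnj b * \<alpha> - of_real a * \<beta>"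
  define V where "V = mat2 \<alpha> \<gamma> \<beta> \<delta>"
  have X': "of_real a * of_real a + b * cnj b = 1"
    using of_real_bloch_norm[of a b] by (simp add: X)
  have XX: "of_real a * \<gamma> + b * \<delta> = \<alpha>" "cnj b * \<gamma> - of_real a * \<delta> = \<beta>"
  proof -
    have "of_real a * \<gamma> + b * \<delta> = (of_real a * of_real a + b * cnj b) * \<alpha>"
      "cnj b * \<gamma> - of_real a * \<delta> = (of_real a * of_real a + b * cnj b) * \<beta>"
      by (simp_all add: \<gamma>_def \<delta>_def algebra_simps)
    then show "of_real a * \<gamma> + b * \<delta> = \<alpha>" "cnj b * \<gamma> - of_real a * \<delta> = \<beta>" by (simp_all add: X')
  qed
  have dot: "2 * of_real a * of_real c + b * cnj w + w * cnj b = 0"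
    using 0 by (simp add: pauli_dot_def complex_eq_iff)
  \<comment> \<open>This is Z X v = - X Z v = - X v in coordinates.\<close>
  have Zv: "of_real c * \<gamma> + w * \<delta> = - \<gamma>" "cnj w * \<gamma> - of_real c * \<delta> = - \<delta>"
  proof -
    have "of_real c * \<gamma> + w * \<delta> + (of_real a * (of_real c * \<alpha> + w * \<beta>) + b * (cnj w * \<alpha> - of_real c * \<beta>))
       = (2 * of_real a * of_real c + b * cnj w + w * cnj b) * \<alpha>"
      by (simp add: \<gamma>_def \<delta>_def algebra_simps)
    then show "of_real c * \<gamma> + w * \<delta> = - \<gamma>" unfolding v \<gamma>_def[symmetric] by (simp add: dot eq_neg_iff_add_eq_0)
    have "cnj w * \<gamma> - of_real c * \<delta> + (cnj b * (of_real c * \<alpha> + w * \<beta>) - of_real a * (cnj w * \<alpha> - of_real c * \<beta>))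
       = (2 * of_real a * of_real c + b * cnj w + w * cnj b) * \<beta>"
      by (simp add: \<gamma>_def \<delta>_def algebra_simps)
    then show "cnj w * \<gamma> - of_real c * \<delta> = - \<delta>" unfolding v \<delta>_def[symmetric] by (simp add: dot eq_neg_iff_add_eq_0)
  qed
  have n1: "cnj \<gamma> * \<gamma> + cnj \<delta> * \<delta> = 1"
  proof -
    have "cnj \<gamma> * \<gamma> + cnj \<delta> * \<delta> = (of_real a * of_real a + b * cnj b) * (\<alpha> * cnj \<alpha> + \<beta> * cnj \<beta>)"
      by (simp add: \<gamma>_def \<delta>_def algebra_simps)
    then show ?thesis by (simp add: X' v)
  qed
  have eq_neg: "x = - x \<Longrightarrow> x = 0" for x :: complex by simp
  \<comment> \<open>Z is Hermitian and has eigenvalues 1 and -1 on the two columns, so their inner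
    product equals its own negative.\<close>
  have h: "cnj \<alpha> * \<gamma> + cnj \<beta> * \<delta> = 0"
  proof -
    have "cnj \<alpha> * \<gamma> + cnj \<beta> * \<delta> = cnj (of_real c * \<alpha> + w * \<beta>) * \<gamma> + cnj (cnj w * \<alpha> - of_real c * \<beta>) * \<delta>"
      by (simp add: v)
    also have "\<dots> = cnj \<alpha> * (of_real c * \<gamma> + w * \<delta>) + cnj \<beta> * (cnj w * \<gamma> - of_real c * \<delta>)"
      by (simp add: algebra_simps)
    also have "\<dots> = - (cnj \<alpha> * \<gamma> + cnj \<beta> * \<delta>)" by (simp add: Zv)
    finally show ?thesis by (rule eq_neg)
  qed
  have h': "cnj \<gamma> * \<alpha> + cnj \<delta> * \<beta> = 0" using arg_cong[OF h, of cnj] by (simp add: mult.commute)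
  have v3: "cnj \<alpha> * \<alpha> + cnj \<beta> * \<beta> = 1"
    using v(3) unfolding mult.commute[of \<alpha>] mult.commute[of \<beta>] .
  have VV: "mat_adjoint V * V = 1\<^sub>m 2"
    unfolding V_def one_mat2 mat2_adjoint mat2_mult mat2_inject
    by (intro conjI v3 n1 h h')
  have c: "V \<in> carrier_mat 2 2" "mat_adjoint V \<in> carrier_mat 2 2" by (simp_all add: V_def)
  have VV': "V * mat_adjoint V = 1\<^sub>m 2"
    by (rule mat_mult_left_right_inverse[OF c(2,1) VV])
  \<comment> \<open>It suffices to compare columns: \<open>A * V = V * B\<close> records how
    \<open>A\<close> acts on the basis.\<close>
  have *: "conj_by (mat_adjoint V) A = B" if "A * V = V * B" "A \<in> carrier_mat 2 2" "B \<in> carrier_mat 2 2" for A B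
  proof -
    have "conj_by (mat_adjoint V) A = mat_adjoint V * (A * V)"
      using c that by (simp add: conj_by_def assoc_mult_mat[of _ 2 2 _ 2 _ 2])
    also have "\<dots> = (mat_adjoint V * V) * B"
      unfolding that(1) using c that by (simp add: assoc_mult_mat[of _ 2 2 _ 2 _ 2])
    finally show ?thesis using that by (simp add: VV)
  qed
  show ?thesis
  proof (rule that[of "mat_adjoint V"])
    show "unitary_mat 2 (mat_adjoint V)" using c VV VV' by (simp add: unitary_mat_def)
    show "conj_by (mat_adjoint V) (pauli a b) = pauli 0 1"
      using XX by (intro *) (auto simp: pauli_def V_def \<gamma>_def \<delta>_def)
    show "conj_by (mat_adjoint V) (pauli c w) = pauli 1 0"
      using Zv v by (intro *) (auto simp: pauli_def V_def)
  qed
qed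

section \<open>The stabilizer basis\<close>

declare One_nat_def [simp del]

section \<open>Conjugation by unitaries and by tensor products of unitaries\<close>

lemma square_mult_carrier:
  "A \<in> carrier_mat d d \<Longrightarrow> B \<in> carrier_mat d d \<Longrightarrow> A * B \<in> carrier_mat d d"
  by (rule mult_carrier_mat)

lemma conj_by_carrier [simp]: "U \<in> carrier_mat d d \<Longrightarrow> A \<in> carrier_mat d d \<Longrightarrow> conj_by U A \<in> carrier_mat d d"
  unfolding conj_by_def by (intro mult_carrier_mat[of _ d d]) auto

lemma unitary_matD:
  assumes "unitary_mat d U"
  shows "U \<in> carrier_mat d d" "U * mat_adjoint U = 1\<^sub>m d" "mat_adjoint U * U = 1\<^sub>m d"
  using assms by (auto simp: unitary_mat_def)

lemma conj_by_one: "unitary_mat d U \<Longrightarrow> conj_by U (1\<^sub>m d) = 1\<^sub>m d"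
  using unitary_matD[of d U] by (simp add: conj_by_def)

lemma conj_by_add:
  assumes "U \<in> carrier_mat d d" "A \<in> carrier_mat d d" "B \<in> carrier_mat d d"
  shows "conj_by U (A + B) = conj_by U A + conj_by U B"
  using assms
  by (simp add: conj_by_def mult_add_distrib_mat[of _ d d _ d] add_mult_distrib_mat[of _ d d _ _ d])

lemma conj_by_minus:
  assumes "U \<in> carrier_mat d d" "A \<in> carrier_mat d d" "B \<in> carrier_mat d d"
  shows "conj_by U (A - B) = conj_by U A - conj_by U B"
  using assms
  by (simp add: conj_by_def mult_minus_distrib_mat[of _ d d _ d] minus_mult_distrib_mat[of _ d d _ _ d])

lemma conj_by_smult:
  assumes "U \<in> carrier_mat d d" "A \<in> carrier_mat d d"
  shows "conj_by U (c \<cdot>\<^sub>m A) = c \<cdot>\<^sub>m conj_by U A"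
  using assms
  by (simp add: conj_by_def mult_smult_distrib[of _ d d _ d] mult_smult_assoc_mat[of _ d d _ d])

lemma conj_by_mult:
  assumes U: "unitary_mat d U" and A: "A \<in> carrier_mat d d" and B: "B \<in> carrier_mat d d"
  shows "conj_by U (A * B) = conj_by U A * conj_by U B"
proof -
  note c = unitary_matD(1)[OF U]
  have "conj_by U A * conj_by U B = U * A * ((mat_adjoint U * U) * (B * mat_adjoint U))"
    using c A B by (simp add: conj_by_def assoc_mult_mat[of _ d d _ d _ d] square_mult_carrier)
  also have "\<dots> = conj_by U (A * B)"
    using c A B by (simp add: unitary_matD[OF U] conj_by_def assoc_mult_mat[of _ d d _ d _ d] square_mult_carrier)
  finally show ?thesis ..
qed

lemma conj_by_adjoint:
  assumes "U \<in> carrier_mat d d" "A \<in> carrier_mat d d"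
  shows "mat_adjoint (conj_by U A) = conj_by U (mat_adjoint A)"
  using assms
  by (simp add: conj_by_def mat_adjoint_mult assoc_mult_mat[of _ d d _ d _ d])

lemma conj_by_mat_sum:
  assumes U: "U \<in> carrier_mat d d" and f: "\<And>x. x \<in> I \<Longrightarrow> f x \<in> carrier_mat d d"
  shows "conj_by U (mat_sum d f I) = mat_sum d (\<lambda>x. conj_by U (f x)) I"
proof -
  have "U * f x \<in> carrier_mat d d" if "x \<in> I" for x
    using U f[OF that] by (rule mult_carrier_mat)
  then show ?thesis using U f
    by (simp add: conj_by_def mult_mat_sum mat_sum_mult)
qed

lemma unitary_tensor:
  assumes "\<And>j. j \<in> {1..n} \<Longrightarrow> unitary_mat d (U j)"
  shows "unitary_mat (d ^ n) (tensor n U)"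
proof -
  have U: "U j \<in> carrier_mat d d" "U j * mat_adjoint (U j) = 1\<^sub>m d" "mat_adjoint (U j) * U j = 1\<^sub>m d"
    if "j \<in> {1..n}" for j
    using unitary_matD[OF assms[OF that]] by auto
  have "tensor n U * tensor n (\<lambda>j. mat_adjoint (U j)) = tensor n (\<lambda>j. 1\<^sub>m d)"
    "tensor n (\<lambda>j. mat_adjoint (U j)) * tensor n U = tensor n (\<lambda>j. 1\<^sub>m d)"
    using U by (subst tensor_mult[where a = d and b = d and c = d]; auto intro!: tensor_cong)+
  moreover have "tensor n U \<in> carrier_mat (d ^ n) (d ^ n)" using U(1) by (rule tensor_carrier)
  ultimately show ?thesis by (simp add: unitary_mat_def tensor_adjoint tensor_one)
qed

lemma conj_by_tensor:
  assumes "\<And>j. j \<in> {1..n} \<Longrightarrow> U j \<in> carrier_mat d d" "\<And>j. j \<in> {1..n} \<Longrightarrow> A j \<in> carrier_mat d d"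
  shows "conj_by (tensor n U) (tensor n A) = tensor n (\<lambda>j. conj_by (U j) (A j))"
proof -
  have UA: "U j * A j \<in> carrier_mat d d" if "j \<in> {1..n}" for j
    using assms that by (intro mult_carrier_mat) auto
  have "conj_by (tensor n U) (tensor n A) = tensor n (\<lambda>j. U j * A j) * tensor n (\<lambda>j. mat_adjoint (U j))"
    unfolding conj_by_def tensor_adjoint using assms
    by (subst tensor_mult[where a = d and b = d and c = d]) auto
  also have "\<dots> = tensor n (\<lambda>j. U j * A j * mat_adjoint (U j))"
    using assms(1) UA by (intro tensor_mult[where a = d and b = d and c = d]) auto
  finally show ?thesis by (simp add: conj_by_def)
qed

lemma tensor_hermitian:
  "(\<And>j. j \<in> {1..n} \<Longrightarrow> mat_adjoint (A j) = A j) \<Longrightarrow> mat_adjoint (tensor n A) = tensor n A"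
  unfolding tensor_adjoint by (rule tensor_cong)

text \<open>With \<open>B = A\<close> it squares the terms of the success operator; with different
  factors it exhibits an inverse, up to a scalar, of a tensor product.\<close>

lemma tensor_mult_scalar:
  assumes "\<And>j. j \<in> {1..n} \<Longrightarrow> A j \<in> carrier_mat d d" "\<And>j. j \<in> {1..n} \<Longrightarrow> B j \<in> carrier_mat d d"
    "\<And>j. j \<in> {1..n} \<Longrightarrow> A j * B j = c j \<cdot>\<^sub>m 1\<^sub>m d"
  shows "tensor n A * tensor n B = (\<Prod>j\<in>{1..n}. c j) \<cdot>\<^sub>m 1\<^sub>m (d ^ n)"
proof -
  have "tensor n A * tensor n B = tensor n (\<lambda>j. c j \<cdot>\<^sub>m 1\<^sub>m d)"
    using assms by (subst tensor_mult[where a = d and b = d and c = d]) (auto intro!: tensor_cong)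
  then show ?thesis by (simp add: tensor_smult tensor_one)
qed

section \<open>Kets, parities and the entangled basis\<close>

lemma ket2_carrier [simp]: "ket2 a b \<in> carrier_mat 2 1"
  by (rule carrier_matI) (simp_all add: ket2_def mat_of_rows_list_def)

lemma ket_carrier [simp]: "ket b \<in> carrier_mat 2 1"
  by (simp add: ket_def)

lemma ket2_index [simp]:
  "dim_row (ket2 a b) = 2" "dim_col (ket2 a b) = 1"
  "ket2 a b $$ (0, 0) = a" "ket2 a b $$ (1, 0) = b" "ket2 a b $$ (Suc 0, 0) = b"
  by (simp_all add: ket2_def mat_of_rows_list_def)

lemma mat2_mult_ket2: "mat2 a b c d * ket2 x y = ket2 (a * x + b * y) (c * x + d * y)"
  by (rule eq_matI) (auto simp: less_Suc_eq scalar_prod_def numeral_2_eq_2)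

lemma smult_ket2: "c \<cdot>\<^sub>m ket2 x y = ket2 (c * x) (c * y)"
  by (rule eq_matI) (auto simp: less_2_cases_iff)

lemma proj_ket2: "proj (ket2 x y) = mat2 (x * cnj x) (x * cnj y) (y * cnj x) (y * cnj y)"
  unfolding proj_def
  by (intro eq_mat2I mult_carrier_mat[of _ 2 1]) (auto simp: scalar_prod_def)

lemma adjoint_ket2_mult: "mat_adjoint (ket2 a b) * ket2 x y = (cnj a * x + cnj b * y) \<cdot>\<^sub>m 1\<^sub>m 1"
  by (rule eq_matI) (auto simp: scalar_prod_def numeral_2_eq_2)

text \<open>Together with \<open>parity_Z n j\<close> for \<open>j\<close> in \<open>{2..n}\<close>,
  these are the stabilizer generators of the GHZ-type basis \<open>xi\<close>.\<close>

definition parity_X :: "nat \<Rightarrow> complex mat" where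
  "parity_X n = tensor n (\<lambda>_. pauli 0 1)"

definition parity_Z :: "nat \<Rightarrow> nat \<Rightarrow> complex mat" where
  "parity_Z n j = tensor n (\<lambda>i. if i = 1 \<or> i = j then pauli 1 0 else 1\<^sub>m 2)"

lemma parity_carrier [simp]:
  "parity_X n \<in> carrier_mat (2 ^ n) (2 ^ n)" "parity_Z n j \<in> carrier_mat (2 ^ n) (2 ^ n)"
  unfolding parity_X_def parity_Z_def by (auto intro!: tensor_carrier)

lemma parity_adjoint:
  "mat_adjoint (parity_X n) = parity_X n" "mat_adjoint (parity_Z n j) = parity_Z n j"
  unfolding parity_X_def parity_Z_def by (auto intro!: tensor_hermitian)

lemma X_ket: "b \<in> {0, 1} \<Longrightarrow> pauli 0 1 * ket b = ket (1 - b)"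
  and Z_ket: "b \<in> {0, 1} \<Longrightarrow> pauli 1 0 * ket b = (- 1) ^ b \<cdot>\<^sub>m ket b"
  by (auto simp: pauli_def ket_def mat2_mult_ket2 smult_ket2)

lemma parity_X_ket:
  assumes "\<And>j. j \<in> {1..n} \<Longrightarrow> f j \<in> {0, 1}"
  shows "parity_X n * tensor n (\<lambda>j. ket (f j)) = tensor n (\<lambda>j. ket (1 - f j))"
  unfolding parity_X_def
  by (subst tensor_mult[where a = 2 and b = 2 and c = 1]; simp?)
    (rule tensor_cong, rule X_ket, rule assms)

lemma parity_Z_ket:
  assumes f: "\<And>j. j \<in> {1..n} \<Longrightarrow> f j \<in> {0, 1}" and j: "j \<in> {2..n}"
  shows "parity_Z n j * tensor n (\<lambda>j. ket (f j)) = (- 1) ^ (f 1 + f j) \<cdot>\<^sub>m tensor n (\<lambda>j. ket (f j))"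
proof -
  have "parity_Z n j * tensor n (\<lambda>j. ket (f j))
      = tensor n (\<lambda>i. (if i = 1 \<or> i = j then (- 1) ^ f i else 1) \<cdot>\<^sub>m ket (f i))"
    unfolding parity_Z_def
  proof (subst tensor_mult[where a = 2 and b = 2 and c = 1])
    show "tensor n (\<lambda>i. (if i = 1 \<or> i = j then pauli 1 0 else 1\<^sub>m 2) * ket (f i))
      = tensor n (\<lambda>i. (if i = 1 \<or> i = j then (- 1) ^ f i else 1) \<cdot>\<^sub>m ket (f i))"
    proof (rule tensor_cong)
      fix i assume "i \<in> {1..n}"
      from Z_ket[OF f[OF this]] show "(if i = 1 \<or> i = j then pauli 1 0 else 1\<^sub>m 2) * ket (f i)
        = (if i = 1 \<or> i = j then (- 1) ^ f i else 1) \<cdot>\<^sub>m ket (f i)"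
        by (auto simp: left_mult_one_mat[OF ket_carrier])
    qed
  qed auto
  also have "\<dots> = (\<Prod>i\<in>{1..n}. if i = 1 \<or> i = j then (- 1) ^ f i else 1) \<cdot>\<^sub>m tensor n (\<lambda>j. ket (f j))"
    by (rule tensor_smult)
  also have "(\<Prod>i\<in>{1..n}. if i = 1 \<or> i = j then (- 1) ^ f i else 1) = (\<Prod>i\<in>{1, j}. (- 1 :: complex) ^ f i)"
    using j by (intro prod.mono_neutral_cong_right) auto
  also have "\<dots> = (- 1) ^ (f 1 + f j)" using j by (simp add: power_add)
  finally show ?thesis .
qed

text \<open>The bit string of one of the two branches of \<open>xi\<close>: qubit 1 carries
  \<open>b\<close>, and for \<open>b = 1\<close> all other bits are complemented. The bit
  \<open>s 1\<close> does not enter, since it is encoded in the relative sign of the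
  branches.\<close>

definition flip_from :: "nat \<Rightarrow> (nat \<Rightarrow> nat) \<Rightarrow> nat \<Rightarrow> nat" where
  "flip_from b s j = (if j = 1 then b else if b = 0 then s j else 1 - s j)"

lemma bitstringsD: "s \<in> bitstrings n \<Longrightarrow> j \<in> {1..n} \<Longrightarrow> s j \<in> {0, 1}"
  by (auto simp: bitstrings_def)

lemma finite_bitstrings [simp]: "finite (bitstrings n)"
  unfolding bitstrings_def by (rule finite_PiE) auto

lemma card_bitstrings: "card (bitstrings n) = 2 ^ n"
  unfolding bitstrings_def by (subst card_PiE) (auto simp: numeral_2_eq_2)

lemma bitstrings_neqE:
  assumes "s \<in> bitstrings n" "t \<in> bitstrings n" "s \<noteq> t"
  obtains j where "j \<in> {1..n}" "s j \<noteq> t j"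
  using assms unfolding bitstrings_def by (metis PiE_ext)

definition branch :: "nat \<Rightarrow> nat \<Rightarrow> (nat \<Rightarrow> nat) \<Rightarrow> complex mat" where
  "branch n b s = tensor n (\<lambda>j. ket (flip_from b s j))"

lemma branch_carrier [simp]: "branch n b s \<in> carrier_mat (2 ^ n) 1"
  unfolding branch_def using tensor_carrier[of n _ 2 1] by simp

lemma xi_branch:
  "xi n s = (1 / complex_of_real (sqrt 2)) \<cdot>\<^sub>m (branch n 0 s + (- 1) ^ s 1 \<cdot>\<^sub>m branch n 1 s)"
  unfolding xi_def branch_def
  by (intro arg_cong2[of _ _ _ _ "\<lambda>A B. _ \<cdot>\<^sub>m (A + _ \<cdot>\<^sub>m B)"] tensor_cong) (auto simp: flip_from_def)

lemma xi_carrier [simp]: "xi n s \<in> carrier_mat (2 ^ n) 1"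
  by (simp add: xi_branch)

lemma mult_xi:
  assumes "A \<in> carrier_mat (2 ^ n) (2 ^ n)"
  shows "A * xi n s = (1 / complex_of_real (sqrt 2)) \<cdot>\<^sub>m (A * branch n 0 s + (- 1) ^ s 1 \<cdot>\<^sub>m (A * branch n 1 s))"
  using assms
  by (simp add: xi_branch mult_add_distrib_mat[of _ "2 ^ n" "2 ^ n" _ 1] mult_smult_distrib[of _ "2 ^ n" "2 ^ n" _ 1])

lemma flip_from_bit: "s \<in> bitstrings n \<Longrightarrow> b \<in> {0, 1} \<Longrightarrow> j \<in> {1..n} \<Longrightarrow> flip_from b s j \<in> {0, 1}"
  using bitstringsD[of s n j] by (auto simp: flip_from_def)

text \<open>Flipping all qubits swaps the two branches, so the relative sign comes out as the
  eigenvalue.\<close>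

lemma parity_X_xi:
  assumes s: "s \<in> bitstrings n" and n: "n \<ge> 1"
  shows "parity_X n * xi n s = (- 1) ^ s 1 \<cdot>\<^sub>m xi n s"
proof -
  have "parity_X n * branch n b s = branch n (1 - b) s" if "b \<in> {0, 1}" for b
    unfolding branch_def
  proof (subst parity_X_ket)
    show "tensor n (\<lambda>j. ket (1 - flip_from b s j)) = tensor n (\<lambda>j. ket (flip_from (1 - b) s j))"
    proof (rule tensor_cong)
      fix j assume "j \<in> {1..n}"
      then show "ket (1 - flip_from b s j) = ket (flip_from (1 - b) s j)"
        using that bitstringsD[OF s, of j] by (auto simp: flip_from_def)
    qed
  qed (rule flip_from_bit[OF s that])
  from this[of 0] this[of 1] have b: "parity_X n * branch n 0 s = branch n 1 s"
    "parity_X n * branch n 1 s = branch n 0 s" by auto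
  show ?thesis unfolding mult_xi[OF parity_carrier(1)] b
    using bitstringsD[OF s, of 1] n branch_carrier[of n 0 s] branch_carrier[of n 1 s]
    by (intro eq_matI) (auto simp: xi_branch algebra_simps simp del: branch_carrier)
qed

text \<open>Qubits 1 and \<open>j\<close> are both flipped between the branches, so their joint
  parity is \<open>s j\<close> in each.\<close>

lemma parity_Z_xi:
  assumes s: "s \<in> bitstrings n" and j: "j \<in> {2..n}"
  shows "parity_Z n j * xi n s = (- 1) ^ s j \<cdot>\<^sub>m xi n s"
proof -
  have "parity_Z n j * branch n b s = (- 1) ^ s j \<cdot>\<^sub>m branch n b s" if "b \<in> {0, 1}" for b
    unfolding branch_def using that flip_from_bit[OF s that] bitstringsD[OF s, of j] j
    by (subst parity_Z_ket) (auto simp: flip_from_def)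
  from this[of 0] this[of 1] have b: "parity_Z n j * branch n 0 s = (- 1) ^ s j \<cdot>\<^sub>m branch n 0 s"
    "parity_Z n j * branch n 1 s = (- 1) ^ s j \<cdot>\<^sub>m branch n 1 s" by auto
  show ?thesis unfolding mult_xi[OF parity_carrier(2)] b
    using branch_carrier[of n 0 s] branch_carrier[of n 1 s]
    by (intro eq_matI) (auto simp: xi_branch algebra_simps simp del: branch_carrier)
qed

lemma ket_inner: "a \<in> {0, 1} \<Longrightarrow> b \<in> {0, 1} \<Longrightarrow> mat_adjoint (ket a) * ket b = of_bool (a = b) \<cdot>\<^sub>m 1\<^sub>m 1"
  by (auto simp: ket_def adjoint_ket2_mult)

text \<open>For \<open>b\<close> different from \<open>c\<close> the factor at qubit 1 is 0, because
  the branches differ there.\<close>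

lemma branch_inner:
  assumes s: "s \<in> bitstrings n" and n: "n \<ge> 1" and b: "b \<in> {0, 1}" "c \<in> {0, 1}"
  shows "mat_adjoint (branch n b s) * branch n c s = of_bool (b = c) \<cdot>\<^sub>m 1\<^sub>m 1"
proof -
  have "mat_adjoint (branch n b s) * branch n c s
     = tensor n (\<lambda>j. of_bool (flip_from b s j = flip_from c s j) \<cdot>\<^sub>m 1\<^sub>m 1)"
    unfolding branch_def tensor_adjoint
    by (subst tensor_mult[where a = 1 and b = 2 and c = 1]; simp?)
      (rule tensor_cong, rule ket_inner; rule flip_from_bit[OF s]; use b in simp)
  also have "\<dots> = (\<Prod>j\<in>{1..n}. of_bool (flip_from b s j = flip_from c s j)) \<cdot>\<^sub>m 1\<^sub>m 1"
    unfolding tensor_smult tensor_one by simp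
  also have "(\<Prod>j\<in>{1..n}. of_bool (flip_from b s j = flip_from c s j)) = (of_bool (b = c) :: complex)"
  proof (cases "b = c")
    case False
    then have "\<exists>j\<in>{1..n}. flip_from b s j \<noteq> flip_from c s j"
      using n by (intro bexI[of _ 1]) (auto simp: flip_from_def)
    then show ?thesis using False by auto
  qed simp
  finally show ?thesis .
qed

text \<open>The branches are orthonormal, so the cross terms vanish and each branch contributes
  1/2.\<close>

lemma xi_norm:
  assumes s: "s \<in> bitstrings n" and n: "n \<ge> 1"
  shows "mat_adjoint (xi n s) * xi n s = 1\<^sub>m 1"
proof -
  let ?r = "1 / complex_of_real (sqrt 2)" and ?e = "(- 1 :: complex) ^ s 1"
  let ?a = "branch n 0 s" and ?b = "branch n 1 s"
  have e: "?e * (?e * x) = x" for x by (simp flip: power_add mult.assoc)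
  have r: "?r * ?r = 1 / 2" by (simp flip: of_real_mult)
  have ip: "(mat_adjoint (branch n b s) * branch n c s) $$ (0, 0)
      = (\<Sum>i<2 ^ n. cnj (branch n b s $$ (i, 0)) * branch n c s $$ (i, 0))" for b c
    using branch_carrier[of n b s] branch_carrier[of n c s]
    by (simp add: scalar_prod_def lessThan_atLeast0 del: branch_carrier)
  have ip': "(\<Sum>i<2 ^ n. cnj (branch n b s $$ (i, 0)) * branch n c s $$ (i, 0)) = of_bool (b = c)"
    if "b \<in> {0, 1}" "c \<in> {0, 1}" for b c
    unfolding ip[symmetric] branch_inner[OF s n that] by simp
  have "(mat_adjoint (xi n s) * xi n s) $$ (0, 0) = (\<Sum>i<2 ^ n. cnj (xi n s $$ (i, 0)) * xi n s $$ (i, 0))"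
    using xi_carrier[of n s] by (simp add: scalar_prod_def lessThan_atLeast0 del: xi_carrier)
  also have "\<dots> = (\<Sum>i<2 ^ n. (?r * ?r) * (cnj (?a $$ (i, 0)) * ?a $$ (i, 0) + cnj (?b $$ (i, 0)) * ?b $$ (i, 0)
      + ?e * (cnj (?a $$ (i, 0)) * ?b $$ (i, 0) + cnj (?b $$ (i, 0)) * ?a $$ (i, 0))))"
  proof (intro sum.cong refl)
    fix i :: nat assume "i \<in> {..<2 ^ n}"
    then have x: "xi n s $$ (i, 0) = ?r * (?a $$ (i, 0) + ?e * ?b $$ (i, 0))"
      using branch_carrier[of n 0 s] branch_carrier[of n 1 s] by (simp add: xi_branch del: branch_carrier)
    have "cnj (?r * (u + ?e * v)) * (?r * (u + ?e * v))
      = (?r * ?r) * (cnj u * u + cnj v * v + ?e * (cnj u * v + cnj v * u))" for u v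
      using e[of "cnj v * v"] by (simp add: algebra_simps)
    then show "cnj (xi n s $$ (i, 0)) * xi n s $$ (i, 0) = (?r * ?r) * (cnj (?a $$ (i, 0)) * ?a $$ (i, 0)
      + cnj (?b $$ (i, 0)) * ?b $$ (i, 0)
      + ?e * (cnj (?a $$ (i, 0)) * ?b $$ (i, 0) + cnj (?b $$ (i, 0)) * ?a $$ (i, 0)))"
      unfolding x .
  qed
  also have "\<dots> = 1"
  proof -
    have "\<dots> = (1 / 2) * ((\<Sum>i<2 ^ n. cnj (?a $$ (i, 0)) * ?a $$ (i, 0)) + (\<Sum>i<2 ^ n. cnj (?b $$ (i, 0)) * ?b $$ (i, 0))
      + ?e * ((\<Sum>i<2 ^ n. cnj (?a $$ (i, 0)) * ?b $$ (i, 0)) + (\<Sum>i<2 ^ n. cnj (?b $$ (i, 0)) * ?a $$ (i, 0))))"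
      by (simp only: r sum_distrib_left sum.distrib distrib_left)
    then show ?thesis by (simp add: ip')
  qed
  finally show ?thesis using xi_carrier[of n s] by (intro eq_matI) (auto simp del: xi_carrier)
qed

lemma hermitian_eigenvectors_orthogonal:
  fixes H :: "complex mat"
  assumes H: "H \<in> carrier_mat d d" "mat_adjoint H = H" and \<phi>: "\<phi> \<in> carrier_mat d 1" and \<psi>: "\<psi> \<in> carrier_mat d 1"
    and e: "H * \<phi> = of_real x \<cdot>\<^sub>m \<phi>" "H * \<psi> = of_real y \<cdot>\<^sub>m \<psi>" "x \<noteq> y"
  shows "mat_adjoint \<phi> * \<psi> = 0\<^sub>m 1 1"
proof -
  have "of_real x \<cdot>\<^sub>m mat_adjoint \<phi> = mat_adjoint \<phi> * H"
    using arg_cong[OF e(1), of mat_adjoint] H \<phi> by (simp add: mat_adjoint_mult mat_adjoint_smult)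
  then have "of_real x \<cdot>\<^sub>m mat_adjoint \<phi> * \<psi> = mat_adjoint \<phi> * (H * \<psi>)"
    using H \<phi> \<psi> by (simp add: assoc_mult_mat[of _ 1 d _ d _ 1])
  then have *: "of_real x \<cdot>\<^sub>m (mat_adjoint \<phi> * \<psi>) = of_real y \<cdot>\<^sub>m (mat_adjoint \<phi> * \<psi>)"
    using \<phi> \<psi> by (simp add: e mult_smult_assoc_mat[of _ 1 d _ 1] mult_smult_distrib[of _ 1 d _ 1])
  have c: "mat_adjoint \<phi> * \<psi> \<in> carrier_mat 1 1" using \<phi> \<psi> by (intro mult_carrier_mat) auto
  show ?thesis
    using arg_cong[OF *, of "\<lambda>A. A $$ (0, 0)"] carrier_matD[OF \<phi>] carrier_matD[OF \<psi>] e(3)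
    by (intro eq_matI) (auto simp del: index_mult_mat(1))
qed

text \<open>The strings differ in some bit \<open>j\<close>, and the parity that reads this bit
  (\<open>parity_X\<close> for \<open>j = 1\<close>, otherwise \<open>parity_Z n j\<close>) has
  opposite eigenvalues on the two vectors.\<close>

lemma xi_orthogonal:
  assumes s: "s \<in> bitstrings n" and t: "t \<in> bitstrings n" and st: "s \<noteq> t"
  shows "mat_adjoint (xi n s) * xi n t = 0\<^sub>m 1 1"
proof -
  obtain j where j: "j \<in> {1..n}" "s j \<noteq> t j" using bitstrings_neqE[OF s t st] .
  have ne: "(- 1 :: real) ^ s j \<noteq> (- 1) ^ t j"
    using bitstringsD[OF s j(1)] bitstringsD[OF t j(1)] j(2) by auto
  show ?thesis
  proof (cases "j = 1")
    case True
    then show ?thesis using ne j parity_X_xi[OF s] parity_X_xi[OF t]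
      by (intro hermitian_eigenvectors_orthogonal[of "parity_X n" "2 ^ n" _ _ "(- 1) ^ s j" "(- 1) ^ t j"])
        (auto simp: parity_adjoint)
  next
    case False
    then have "j \<in> {2..n}" using j by auto
    then show ?thesis using ne parity_Z_xi[OF s] parity_Z_xi[OF t]
      by (intro hermitian_eigenvectors_orthogonal[of "parity_Z n j" "2 ^ n" _ _ "(- 1) ^ s j" "(- 1) ^ t j"])
        (auto simp: parity_adjoint)
  qed
qed

text \<open>There are \<open>2 ^ n\<close> orthonormal vectors in dimension \<open>2 ^ n\<close>:
  the square matrix \<open>V\<close> with these columns has a left inverse, which is then a right
  inverse, and that is completeness.\<close>

lemma sum_proj_xi:
  assumes n: "n \<ge> 1"
  shows "mat_sum (2 ^ n) (\<lambda>s. proj (xi n s)) (bitstrings n) = 1\<^sub>m (2 ^ n)"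
proof -
  obtain h where h: "bij_betw h {..<(2 :: nat) ^ n} (bitstrings n)"
    using ex_bij_betw_nat_finite[OF finite_bitstrings, of n] by (auto simp: card_bitstrings lessThan_atLeast0)
  define V where "V = mat (2 ^ n) (2 ^ n) (\<lambda>(i, k). xi n (h k) $$ (i, 0))"
  have V: "V \<in> carrier_mat (2 ^ n) (2 ^ n)" by (simp add: V_def)
  have "mat_adjoint V * V = 1\<^sub>m (2 ^ n)"
  proof (rule eq_matI)
    fix i k assume "i < dim_row (1\<^sub>m (2 ^ n) :: complex mat)" "k < dim_col (1\<^sub>m (2 ^ n) :: complex mat)"
    then have ik: "i < 2 ^ n" "k < 2 ^ n" by auto
    then have hb: "h i \<in> bitstrings n" "h k \<in> bitstrings n" using bij_betwE[OF h] by auto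
    have "(mat_adjoint V * V) $$ (i, k) = (\<Sum>l<2 ^ n. cnj (xi n (h i) $$ (l, 0)) * xi n (h k) $$ (l, 0))"
      using ik by (simp add: V_def scalar_prod_def lessThan_atLeast0)
    also have "\<dots> = (mat_adjoint (xi n (h i)) * xi n (h k)) $$ (0, 0)"
      using xi_carrier[of n "h i"] xi_carrier[of n "h k"]
      by (simp add: scalar_prod_def lessThan_atLeast0 del: xi_carrier)
    also have "\<dots> = of_bool (i = k)"
    proof (cases "i = k")
      case True
      then show ?thesis using xi_norm[OF hb(1) n] by simp
    next
      case False
      then have "h i \<noteq> h k" using h ik by (auto simp: bij_betw_def inj_on_def)
      then show ?thesis using xi_orthogonal[OF hb] False by simp
    qed
    finally show "(mat_adjoint V * V) $$ (i, k) = 1\<^sub>m (2 ^ n) $$ (i, k)" using ik by simp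
  qed (simp_all add: V_def)
  then have VV: "V * mat_adjoint V = 1\<^sub>m (2 ^ n)"
    by (rule mat_mult_left_right_inverse[rotated 2]) (simp_all add: V)
  show ?thesis unfolding VV[symmetric]
  proof (rule eq_matI)
    fix i k assume "i < dim_row (V * mat_adjoint V)" "k < dim_col (V * mat_adjoint V)"
    then have ik: "i < 2 ^ n" "k < 2 ^ n" by (auto simp: V_def)
    have "(V * mat_adjoint V) $$ (i, k) = (\<Sum>l<2 ^ n. xi n (h l) $$ (i, 0) * cnj (xi n (h l) $$ (k, 0)))"
      using ik by (simp add: V_def scalar_prod_def lessThan_atLeast0)
    also have "\<dots> = (\<Sum>s\<in>bitstrings n. xi n s $$ (i, 0) * cnj (xi n s $$ (k, 0)))"
      by (rule sum.reindex_bij_betw[OF h])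
    also have "\<dots> = (\<Sum>s\<in>bitstrings n. proj (xi n s) $$ (i, k))"
    proof (intro sum.cong refl)
      fix s
      show "xi n s $$ (i, 0) * cnj (xi n s $$ (k, 0)) = proj (xi n s) $$ (i, k)"
        using ik xi_carrier[of n s] by (simp add: proj_def scalar_prod_def One_nat_def del: xi_carrier)
    qed
    finally show "mat_sum (2 ^ n) (\<lambda>s. proj (xi n s)) (bitstrings n) $$ (i, k) = (V * mat_adjoint V) $$ (i, k)"
      using ik by (simp add: mat_sum_def)
  qed (simp_all add: V_def mat_sum_def)
qed

text \<open>\<open>M s \<xi>\<^sub>t\<close> vanishes for \<open>t \<noteq> s\<close>, because some parity takes different values on the two; hence
  \<open>M s = M s (\<Sum>t. |\<xi>\<^sub>t\<rangle>\<langle>\<xi>\<^sub>t|) = M s |\<xi>\<^sub>s\<rangle>\<langle>\<xi>\<^sub>s|\<close>, and \<open>M s \<xi>\<^sub>s = (\<Sum>t. M t) \<xi>\<^sub>s = \<xi>\<^sub>s\<close>.\<close>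

lemma povm_stabilized_eq_proj_xi:
  assumes n: "n \<ge> 1"
    and M: "\<And>s. s \<in> bitstrings n \<Longrightarrow> M s \<in> carrier_mat (2 ^ n) (2 ^ n)"
    and herm: "\<And>s. s \<in> bitstrings n \<Longrightarrow> mat_adjoint (M s) = M s"
    and sum: "mat_sum (2 ^ n) M (bitstrings n) = 1\<^sub>m (2 ^ n)"
    and X: "\<And>s. s \<in> bitstrings n \<Longrightarrow> parity_X n * M s = (- 1) ^ s 1 \<cdot>\<^sub>m M s"
    and Z: "\<And>s j. s \<in> bitstrings n \<Longrightarrow> j \<in> {2..n} \<Longrightarrow> parity_Z n j * M s = (- 1) ^ s j \<cdot>\<^sub>m M s"
    and s: "s \<in> bitstrings n"
  shows "M s = proj (xi n s)"
proof -
  let ?N = "2 ^ n :: nat"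
  have orth: "M s * proj (xi n t) = 0\<^sub>m ?N ?N"
    if s: "s \<in> bitstrings n" and t: "t \<in> bitstrings n" and st: "s \<noteq> t" for s t
  proof -
    obtain j where j: "j \<in> {1..n}" "s j \<noteq> t j" using bitstrings_neqE[OF s t st] .
    have ne: "(- 1 :: complex) ^ s j \<noteq> (- 1) ^ t j"
      using bitstringsD[OF s j(1)] bitstringsD[OF t j(1)] j(2) by auto
    have "M s * xi n t = 0\<^sub>m ?N 1"
      if H: "H \<in> carrier_mat ?N ?N" "mat_adjoint H = H"
        "H * M s = (- 1) ^ s j \<cdot>\<^sub>m M s" "H * xi n t = (- 1) ^ t j \<cdot>\<^sub>m xi n t" for H
    proof -
      \<comment> \<open>\<open>H\<close> is the parity that separates \<open>s\<close> from
        \<open>t\<close>. Adjoints bring it to the right of \<open>M s\<close>, where it can act on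
        \<open>xi n t\<close>.\<close>
      have "M s * H = (- 1) ^ s j \<cdot>\<^sub>m M s"
        using arg_cong[OF H(3), of mat_adjoint] H(1,2) M[OF s] herm[OF s]
        by (simp add: mat_adjoint_mult mat_adjoint_smult)
      then have "(- 1) ^ s j \<cdot>\<^sub>m M s * xi n t = M s * (H * xi n t)"
        using H(1) M[OF s] assoc_mult_mat[of "M s" ?N ?N H ?N "xi n t" 1] by simp
      then have *: "(- 1) ^ s j \<cdot>\<^sub>m (M s * xi n t) = (- 1) ^ t j \<cdot>\<^sub>m (M s * xi n t)"
        using M[OF s] by (simp add: H(4) mult_smult_assoc_mat[of _ ?N ?N _ 1] mult_smult_distrib[of _ ?N ?N _ 1])
      have c: "M s * xi n t \<in> carrier_mat ?N 1" using M[OF s] by (rule mult_carrier_mat) simp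
      show ?thesis
      proof (rule eq_matI)
        fix i k assume "i < dim_row (0\<^sub>m ?N 1 :: complex mat)" "k < dim_col (0\<^sub>m ?N 1 :: complex mat)"
        then have ik: "i < ?N" "k < 1" by auto
        then have "(- 1) ^ s j * (M s * xi n t) $$ (i, k) = (- 1) ^ t j * (M s * xi n t) $$ (i, k)"
          using arg_cong[OF *, of "\<lambda>A. A $$ (i, k)"] M[OF s] xi_carrier[of n t] by (simp del: index_mult_mat(1) xi_carrier)
        with ne ik show "(M s * xi n t) $$ (i, k) = 0\<^sub>m ?N 1 $$ (i, k)" by simp
      qed (use c in auto)
    qed
    from this[of "parity_X n"] this[of "parity_Z n j"] have "M s * xi n t = 0\<^sub>m ?N 1"
      using j n X[OF s] Z[OF s, of j] parity_X_xi[OF t n] parity_Z_xi[OF t, of j]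
      by (cases "j = 1") (auto simp: parity_adjoint)
    moreover have "M s * proj (xi n t) = M s * xi n t * mat_adjoint (xi n t)"
      unfolding proj_def using M[OF s] by (simp add: assoc_mult_mat[of _ ?N ?N _ 1 _ ?N])
    ultimately show ?thesis using left_mult_zero_mat[of "mat_adjoint (xi n t)" 1 ?N ?N] by simp
  qed
  have pc: "proj (xi n t) \<in> carrier_mat ?N ?N" for t by (rule proj_carrier[OF xi_carrier])
  have "M s = M s * mat_sum ?N (\<lambda>t. proj (xi n t)) (bitstrings n)"
    unfolding sum_proj_xi[OF n] using M[OF s] by simp
  also have "\<dots> = mat_sum ?N (\<lambda>t. M s * proj (xi n t)) (bitstrings n)"
    using M[OF s] pc by (rule mult_mat_sum)
  also have "\<dots> = M s * proj (xi n s)"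
    using orth[OF s] s M[OF s] pc by (intro mat_sum_single) (auto intro!: square_mult_carrier)
  \<comment> \<open>The same vanishing, now with the projector fixed and the effect varying, brings
    in the completeness of the POVM.\<close>
  also have "\<dots> = mat_sum ?N (\<lambda>t. M t * proj (xi n s)) (bitstrings n)"
    using orth[OF _ s] s M[OF s] pc by (intro mat_sum_single[symmetric]) (auto intro!: square_mult_carrier)
  also have "\<dots> = mat_sum ?N M (bitstrings n) * proj (xi n s)"
    using pc M by (intro mat_sum_mult[symmetric]) auto
  finally show ?thesis using pc[of s] by (simp add: sum)
qed

section \<open>The success metric of a strategy\<close>

lemma povmD:
  assumes "povm n M"
  shows "\<And>s. s \<in> bitstrings n \<Longrightarrow> psd (2 ^ n) (M s)"
    "\<And>s. s \<in> bitstrings n \<Longrightarrow> M s \<in> carrier_mat (2 ^ n) (2 ^ n)"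
    "\<And>s. s \<in> bitstrings n \<Longrightarrow> mat_adjoint (M s) = M s"
    "mat_sum (2 ^ n) M (bitstrings n) = 1\<^sub>m (2 ^ n)"
  using assms by (auto simp: povm_def intro: psdD)

lemma sign_sign [simp]: "(- 1 :: complex) ^ k * ((- 1) ^ k * x) = x"
  by (simp flip: power_add mult.assoc)

lemma smult_smult_mat: "c \<cdot>\<^sub>m (d \<cdot>\<^sub>m A) = (c * d :: complex) \<cdot>\<^sub>m A"
  by (rule eq_matI) auto

text \<open>The senders enter only through the Bloch vectors of their observables, as the metric
  does not see more of the states. Purity of the states is recovered separately by
  \<open>pauli_strategy_exists\<close>.\<close>

locale pauli_strategy =
  fixes n :: nat and \<rho> :: "nat \<Rightarrow> nat \<Rightarrow> nat \<Rightarrow> complex mat" and M :: "(nat \<Rightarrow> nat) \<Rightarrow> complex mat"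
    and a :: "nat \<Rightarrow> nat \<Rightarrow> real" and b :: "nat \<Rightarrow> nat \<Rightarrow> complex"
  assumes n: "n \<ge> 2" and povm: "povm n M"
    and obs: "\<And>j x. j \<in> {1..n} \<Longrightarrow> x \<in> {0, 1} \<Longrightarrow> obs \<rho> j x = pauli (a j x) (b j x)"
    and norm_le: "\<And>j x. j \<in> {1..n} \<Longrightarrow> x \<in> {0, 1} \<Longrightarrow> (a j x)\<^sup>2 + (cmod (b j x))\<^sup>2 \<le> 1"
begin

abbreviation N :: nat where "N \<equiv> 2 ^ n"

text \<open>The squared length of a Bloch vector; \<open>S_len\<close> and \<open>D_len\<close> are
  squared lengths too.\<close>

definition len :: "nat \<Rightarrow> nat \<Rightarrow> real" where
  "len j x = (a j x)\<^sup>2 + (cmod (b j x))\<^sup>2"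

text \<open>\<open>S_op\<close> and \<open>D_op\<close> are the sum and the difference of the two observables of sender 1; \<open>T1 s\<close> and
  \<open>T2 s j\<close> are the terms of \<open>\<W>\<^sub>s\<close>, without the weight \<open>n - 1\<close>, and \<open>t\<close> and \<open>u j\<close> the scalars to which
  they square.\<close>

definition S_op :: "complex mat" where "S_op = pauli (a 1 0 + a 1 1) (b 1 0 + b 1 1)"
definition D_op :: "complex mat" where "D_op = pauli (a 1 0 - a 1 1) (b 1 0 - b 1 1)"
definition S_len :: real where "S_len = (a 1 0 + a 1 1)\<^sup>2 + (cmod (b 1 0 + b 1 1))\<^sup>2"
definition D_len :: real where "D_len = (a 1 0 - a 1 1)\<^sup>2 + (cmod (b 1 0 - b 1 1))\<^sup>2"

definition T1 :: "(nat \<Rightarrow> nat) \<Rightarrow> complex mat" where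
  "T1 s = (- 1) ^ s 1 \<cdot>\<^sub>m tensor n (\<lambda>i. if i = 1 then S_op else pauli (a i 0) (b i 0))"

definition T2 :: "(nat \<Rightarrow> nat) \<Rightarrow> nat \<Rightarrow> complex mat" where
  "T2 s j = (- 1) ^ s j \<cdot>\<^sub>m tensor n (\<lambda>i. if i = 1 then D_op else if i = j then pauli (a i 1) (b i 1) else 1\<^sub>m 2)"

definition t :: real where "t = S_len * (\<Prod>i\<in>{2..n}. len i 0)"
definition u :: "nat \<Rightarrow> real" where "u j = D_len * len j 1"

definition G1 :: "(nat \<Rightarrow> nat) \<Rightarrow> complex" where
  "G1 s = mat_trace (M s * (sos N (T1 s) * sos N (T1 s)))"
definition G2 :: "(nat \<Rightarrow> nat) \<Rightarrow> nat \<Rightarrow> complex" where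
  "G2 s j = mat_trace (M s * (sos N (T2 s j) * sos N (T2 s j)))"

lemma SD_carrier [simp]: "S_op \<in> carrier_mat 2 2" "D_op \<in> carrier_mat 2 2"
  by (simp_all add: S_op_def D_op_def)

lemma SD_adjoint [simp]: "mat_adjoint S_op = S_op" "mat_adjoint D_op = D_op"
  by (simp_all add: S_op_def D_op_def)

lemma SD_square: "S_op * S_op = of_real S_len \<cdot>\<^sub>m 1\<^sub>m 2" "D_op * D_op = of_real D_len \<cdot>\<^sub>m 1\<^sub>m 2"
  unfolding S_op_def D_op_def S_len_def D_len_def by (rule pauli_square)+

lemma T_carrier [simp]: "T1 s \<in> carrier_mat N N" "T2 s j \<in> carrier_mat N N"
  unfolding T1_def T2_def by (auto intro!: tensor_carrier smult_carrier_mat)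

lemma T_adjoint: "mat_adjoint (T1 s) = T1 s" "mat_adjoint (T2 s j) = T2 s j"
  unfolding T1_def T2_def mat_adjoint_smult
  by (subst tensor_hermitian; auto)+

lemma prod_split: "(\<Prod>i\<in>{1..n}. f i) = f 1 * (\<Prod>i\<in>{2..n}. f i :: 'a :: comm_monoid_mult)"
proof -
  have "{1..n} = insert 1 {2..n}" using n by auto
  then show ?thesis by simp
qed

lemma T1_square: "T1 s * T1 s = of_real t \<cdot>\<^sub>m 1\<^sub>m N"
proof -
  let ?A = "\<lambda>i. if i = 1 then S_op else pauli (a i 0) (b i 0)"
  have "tensor n ?A * tensor n ?A = (\<Prod>i\<in>{1..n}. of_real (if i = 1 then S_len else len i 0)) \<cdot>\<^sub>m 1\<^sub>m N"
    by (rule tensor_mult_scalar) (auto simp: SD_square pauli_square len_def)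
  also have "(\<Prod>i\<in>{1..n}. of_real (if i = 1 then S_len else len i 0)) = (of_real t :: complex)"
    unfolding prod_split t_def by simp
  finally have *: "tensor n ?A * tensor n ?A = of_real t \<cdot>\<^sub>m 1\<^sub>m N" .
  have c: "tensor n ?A \<in> carrier_mat N N" by (auto intro!: tensor_carrier)
  show ?thesis unfolding T1_def using c * 
    by (simp add: mult_smult_assoc_mat[of _ N N _ N] mult_smult_distrib[of _ N N _ N] square_mult_carrier)
      (simp add: smult_smult_mat mult_ac)
qed

lemma T2_square:
  assumes "j \<in> {2..n}"
  shows "T2 s j * T2 s j = of_real (u j) \<cdot>\<^sub>m 1\<^sub>m N"
proof -
  let ?A = "\<lambda>i. if i = 1 then D_op else if i = j then pauli (a i 1) (b i 1) else 1\<^sub>m 2"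
  have "tensor n ?A * tensor n ?A
      = (\<Prod>i\<in>{1..n}. of_real (if i = 1 then D_len else if i = j then len i 1 else 1)) \<cdot>\<^sub>m 1\<^sub>m N"
    by (rule tensor_mult_scalar) (auto simp: SD_square pauli_square len_def)
  also have "(\<Prod>i\<in>{1..n}. of_real (if i = 1 then D_len else if i = j then len i 1 else 1)) = (of_real (u j) :: complex)"
  proof -
    have "(\<Prod>i\<in>{2..n}. if i = 1 then D_len else if i = j then len i 1 else 1) = (\<Prod>i\<in>{2..n}. if i = j then len i 1 else 1)"
      by (intro prod.cong) auto
    also have "\<dots> = len j 1" using assms by simp
    finally show ?thesis unfolding prod_split u_def by (simp flip: of_real_prod)
  qed
  finally have *: "tensor n ?A * tensor n ?A = of_real (u j) \<cdot>\<^sub>m 1\<^sub>m N" .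
  have c: "tensor n ?A \<in> carrier_mat N N" by (auto intro!: tensor_carrier)
  show ?thesis unfolding T2_def using c *
    by (simp add: mult_smult_assoc_mat[of _ N N _ N] mult_smult_distrib[of _ N N _ N] square_mult_carrier)
      (simp add: smult_smult_mat mult_ac)
qed

lemma W_op_eq: "W_op n \<rho> s = (of_nat n - 1) \<cdot>\<^sub>m T1 s + mat_sum N (T2 s) {2..n}"
proof -
  have "tensor n (\<lambda>i. if i = 1 then obs \<rho> 1 0 + obs \<rho> 1 1 else obs \<rho> i 0)
      = tensor n (\<lambda>i. if i = 1 then S_op else pauli (a i 0) (b i 0))"
    using n by (intro tensor_cong) (auto simp: obs S_op_def pauli_add)
  moreover have "tensor n (\<lambda>i. if i = 1 then obs \<rho> 1 0 - obs \<rho> 1 1 else if i = j then obs \<rho> j 1 else 1\<^sub>m 2)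
      = tensor n (\<lambda>i. if i = 1 then D_op else if i = j then pauli (a i 1) (b i 1) else 1\<^sub>m 2)" for j
    using n by (intro tensor_cong) (auto simp: obs D_op_def pauli_minus)
  ultimately show ?thesis
    by (simp add: W_op_def T1_def T2_def[abs_def] smult_smult_mat)
qed

lemma sum_trace_M: "(\<Sum>s\<in>bitstrings n. mat_trace (M s)) = 2 ^ n"
  using mat_trace_mat_sum[of "bitstrings n" M N] povmD(2,4)[OF povm] by simp

lemma trace_W:
  assumes s: "s \<in> bitstrings n"
  shows "2 * complex_of_real (sqrt 2) * mat_trace (M s * W_op n \<rho> s)
    = (\<Sum>j\<in>{2..n}. of_real (4 + t + u j) * mat_trace (M s) - (G1 s + G2 s j))"
proof -
  let ?c = "2 * complex_of_real (sqrt 2)"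
  note MC = povmD(2)[OF povm s]
  have MT: "M s * T1 s \<in> carrier_mat N N" "M s * T2 s j \<in> carrier_mat N N" for j
    using MC by (auto intro!: square_mult_carrier)
  have "M s * W_op n \<rho> s = (of_nat n - 1) \<cdot>\<^sub>m (M s * T1 s) + mat_sum N (\<lambda>j. M s * T2 s j) {2..n}"
    unfolding W_op_eq using MC
    by (simp add: mult_add_distrib_mat[of _ N N _ N] mult_smult_distrib[of _ N N _ N] mult_mat_sum)
  then have "mat_trace (M s * W_op n \<rho> s) = (of_nat n - 1) * mat_trace (M s * T1 s) + (\<Sum>j\<in>{2..n}. mat_trace (M s * T2 s j))"
    using MT by (simp add: mat_trace_add[of _ N] mat_trace_smult[of _ N] mat_trace_mat_sum)
  \<comment> \<open>The weight is the number of indices \<open>j\<close>, so the sum over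
    \<open>j\<close> absorbs one copy of the first term for each.\<close>
  also have "(of_nat n - 1 :: complex) = of_nat (card {2..n})"
    using n by simp
  finally have "?c * mat_trace (M s * W_op n \<rho> s)
      = (\<Sum>j\<in>{2..n}. ?c * mat_trace (M s * T1 s) + ?c * mat_trace (M s * T2 s j))"
    by (simp add: sum.distrib sum_distrib_left distrib_left)
  also have "\<dots> = (\<Sum>j\<in>{2..n}. of_real (4 + t + u j) * mat_trace (M s) - (G1 s + G2 s j))"
  proof (intro sum.cong refl)
    fix j assume j: "j \<in> {2..n}"
    show "?c * mat_trace (M s * T1 s) + ?c * mat_trace (M s * T2 s j)
      = of_real (4 + t + u j) * mat_trace (M s) - (G1 s + G2 s j)"
      unfolding mat_trace_sos[OF MC T_carrier(1) T1_square] mat_trace_sos[OF MC T_carrier(2) T2_square[OF j]]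
      by (simp add: G1_def G2_def algebra_simps)
  qed
  finally show ?thesis .
qed

text \<open>The loss of a strategy, up to the factor \<open>8 * 2 ^ n * (n - 1)\<close>. The first
  part measures how far the Bloch vectors fall short, the second how far the effects are from the
  eigenspaces for sqrt 2.\<close>

definition defect :: complex where
  "defect = (\<Sum>j\<in>{2..n}. of_real (4 - t - u j) * 2 ^ n + (\<Sum>s\<in>bitstrings n. G1 s + G2 s j))"

text \<open>One factor 2 sqrt 2 comes from the normalization of the metric, another from
  \<open>trace_W\<close>. Their product 8 matches the largest possible value of
  \<open>4 + t + u j\<close>, which is why the constant is exactly 1.\<close>

lemma success_eq: "success n \<rho> M = 1 - defect / of_real (8 * 2 ^ n * (real n - 1))"
proof -
  let ?c = "2 * complex_of_real (sqrt 2)" and ?K = "of_real (2 ^ n * (real n - 1)) :: complex"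
  have cc: "?c * ?c = 8" using sqrt2_mult(1) by (simp add: mult_ac)
  have c0: "?c \<noteq> 0" by simp
  have K0: "?K \<noteq> 0" using n by simp
  have K: "(\<Sum>j\<in>{2..n}. 8 * 2 ^ n) = 8 * ?K"
    using n by simp
  define W where "W = (\<Sum>s\<in>bitstrings n. mat_trace (M s * W_op n \<rho> s))"
  have "?c * W = (\<Sum>s\<in>bitstrings n. \<Sum>j\<in>{2..n}. of_real (4 + t + u j) * mat_trace (M s) - (G1 s + G2 s j))"
    unfolding W_def sum_distrib_left by (intro sum.cong refl trace_W)
  also have "\<dots> = (\<Sum>j\<in>{2..n}. \<Sum>s\<in>bitstrings n. of_real (4 + t + u j) * mat_trace (M s) - (G1 s + G2 s j))"
    by (rule sum.swap)
  also have "\<dots> = (\<Sum>j\<in>{2..n}. of_real (4 + t + u j) * 2 ^ n - (\<Sum>s\<in>bitstrings n. G1 s + G2 s j))"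
    unfolding sum_subtractf[of _ _ "bitstrings n"] sum_distrib_left[symmetric] sum_trace_M ..
  also have "\<dots> = (\<Sum>j\<in>{2..n}. 8 * 2 ^ n) - defect"
    unfolding defect_def sum_subtractf[symmetric] by (intro sum.cong refl) (simp add: algebra_simps)
  finally have "?c * W = 8 * ?K - defect" unfolding K .
  moreover have "success n \<rho> M = ?c * W / (?c * ?c * ?K)"
    using c0 by (simp add: success_def W_def mult_ac)
  ultimately have "success n \<rho> M = (8 * ?K - defect) / (8 * ?K)" by (simp only: cc)
  also have "\<dots> = 1 - defect / (8 * ?K)" using K0 by (simp add: diff_divide_distrib)
  finally show ?thesis by (simp add: mult_ac)
qed

lemma len_bounds: "j \<in> {1..n} \<Longrightarrow> x \<in> {0, 1} \<Longrightarrow> 0 \<le> len j x \<and> len j x \<le> 1"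
  using norm_le[of j x] by (auto simp: len_def)

text \<open>The equation is the parallelogram law for the two Bloch vectors of sender 1.\<close>

lemma SD_len: "S_len \<ge> 0" "D_len \<ge> 0" "S_len + D_len = 2 * (len 1 0 + len 1 1)"
proof -
  show "S_len + D_len = 2 * (len 1 0 + len 1 1)"
    unfolding S_len_def D_len_def len_def cmod_power2 by (simp add: power2_eq_square algebra_simps)
qed (simp_all add: S_len_def D_len_def)

lemma SD_len_le: "S_len + D_len \<le> 4"
  using SD_len(3) len_bounds[of 1 0] len_bounds[of 1 1] n by auto

lemma prod_len_bounds: "0 \<le> (\<Prod>i\<in>{2..n}. len i 0)" "(\<Prod>i\<in>{2..n}. len i 0) \<le> 1"
  using len_bounds by (auto intro!: prod_nonneg prod_le_1)

lemma t_le: "t \<le> S_len"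
  unfolding t_def using prod_len_bounds SD_len(1) by (intro mult_right_le_one_le)

lemma u_le: "j \<in> {2..n} \<Longrightarrow> u j \<le> D_len"
  unfolding u_def using len_bounds[of j 1] SD_len(2) by (intro mult_right_le_one_le) auto

lemma G_nonneg:
  assumes "s \<in> bitstrings n"
  shows "0 \<le> G1 s" "0 \<le> G2 s j"
  unfolding G1_def G2_def using povmD(1)[OF povm assms] T_adjoint
  by (auto intro!: mat_trace_sos_nonneg)

lemma defect_summand_nonneg:
  assumes "j \<in> {2..n}"
  shows "0 \<le> complex_of_real (4 - t - u j) * 2 ^ n" "0 \<le> (\<Sum>s\<in>bitstrings n. G1 s + G2 s j)"
proof -
  have "0 \<le> (4 - t - u j) * 2 ^ n"
    using t_le u_le[OF assms] SD_len_le by simp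
  then have "0 \<le> complex_of_real ((4 - t - u j) * 2 ^ n)" by (simp only: less_eq_complex_def) simp
  then show "0 \<le> complex_of_real (4 - t - u j) * 2 ^ n" by simp
  show "0 \<le> (\<Sum>s\<in>bitstrings n. G1 s + G2 s j)"
    using G_nonneg by (intro sum_nonneg add_nonneg_nonneg)
qed

lemma defect_nonneg: "0 \<le> defect"
  unfolding defect_def by (rule sum_nonneg, rule add_nonneg_nonneg) (rule defect_summand_nonneg; assumption)+

lemma success_real_le: "success n \<rho> M \<in> \<real> \<and> Re (success n \<rho> M) \<le> 1"
proof -
  \<comment> \<open>Nonnegativity in the order on complex numbers includes being real.\<close>
  have "defect = of_real (Re defect)" "Re defect \<ge> 0"
    using defect_nonneg by (auto simp: less_eq_complex_def complex_eq_iff)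
  then obtain d where d: "defect = of_real d" "d \<ge> 0" by metis
  have "success n \<rho> M = of_real (1 - d / (8 * 2 ^ n * (real n - 1)))"
    unfolding success_eq d by simp
  moreover have "d / (8 * 2 ^ n * (real n - 1)) \<ge> 0" using d n by simp
  ultimately show ?thesis by simp
qed

lemma success_1_iff: "success n \<rho> M = 1 \<longleftrightarrow> defect = 0"
proof -
  have "complex_of_real (8 * 2 ^ n * (real n - 1)) \<noteq> 0" using n by simp
  then show ?thesis unfolding success_eq by simp
qed

lemma defect_eq_0D:
  assumes "defect = 0" and j: "j \<in> {2..n}"
  shows "t + u j = 4" "s \<in> bitstrings n \<Longrightarrow> G1 s = 0" "s \<in> bitstrings n \<Longrightarrow> G2 s j = 0"
proof -
  have "of_real (4 - t - u j) * 2 ^ n + (\<Sum>s\<in>bitstrings n. G1 s + G2 s j) = 0"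
    using assms defect_summand_nonneg unfolding defect_def
    by (subst (asm) sum_nonneg_eq_0_iff) (auto intro!: add_nonneg_nonneg simp del: of_real_diff)
  then have 0: "of_real (4 - t - u j) * 2 ^ n = (0 :: complex)" "(\<Sum>s\<in>bitstrings n. G1 s + G2 s j) = 0"
    using add_nonneg_eq_0_iff[OF defect_summand_nonneg[OF j]] by auto
  from 0(1) have "complex_of_real (4 - t - u j) = 0" by (simp del: of_real_diff)
  then show "t + u j = 4" unfolding of_real_eq_0_iff by simp
  assume s: "s \<in> bitstrings n"
  have "G1 s + G2 s j = 0"
    using 0(2) s G_nonneg by (subst (asm) sum_nonneg_eq_0_iff) (auto intro!: add_nonneg_nonneg)
  then show "G1 s = 0" "G2 s j = 0" using add_nonneg_eq_0_iff[OF G_nonneg[OF s]] by auto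
qed

end

section \<open>Optimal strategies\<close>

lemma one_smult_mat [simp]: "1 \<cdot>\<^sub>m A = (A :: complex mat)"
  by (rule eq_matI) auto

lemma nonzero_mat_index:
  assumes "A \<in> carrier_mat m k" "A \<noteq> 0\<^sub>m m k"
  obtains i l where "i < m" "l < k" "A $$ (i, l) \<noteq> 0"
  using assms by (metis eq_matI carrier_matD index_zero_mat)

lemma smult_eq_smult_imp:
  assumes "c \<cdot>\<^sub>m A = d \<cdot>\<^sub>m A" "A \<in> carrier_mat m k" "A \<noteq> 0\<^sub>m m k"
  shows "c = (d :: complex)"
proof -
  obtain i l where il: "i < m" "l < k" "A $$ (i, l) \<noteq> 0" using nonzero_mat_index[OF assms(2,3)] .
  then show ?thesis using arg_cong[OF assms(1), of "\<lambda>A. A $$ (i, l)"] assms(2) by simp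
qed

lemma eigen_mult:
  assumes "A \<in> carrier_mat d d" "B \<in> carrier_mat d d" "M \<in> carrier_mat d d"
    and "A * M = x \<cdot>\<^sub>m M" "B * M = y \<cdot>\<^sub>m M"
  shows "A * B * M = (x * y :: complex) \<cdot>\<^sub>m M"
  using assms
  by (simp add: assoc_mult_mat[of _ d d _ d _ d] mult_smult_distrib[of _ d d _ d] smult_smult_mat mult.commute)

text \<open>\<open>T * T * M\<close> equals both \<open>c\<close> times \<open>M\<close> and 2 times
  \<open>M\<close>, and \<open>M\<close> is nonzero.\<close>

lemma eigen_square:
  assumes T: "T \<in> carrier_mat d d" "T * T = c \<cdot>\<^sub>m 1\<^sub>m d"
    and M: "M \<in> carrier_mat d d" "M \<noteq> 0\<^sub>m d d" and TM: "T * M = complex_of_real (sqrt 2) \<cdot>\<^sub>m M"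
  shows "c = 2"
proof -
  have "c \<cdot>\<^sub>m M = 2 \<cdot>\<^sub>m M"
    using eigen_mult[OF T(1) T(1) M(1) TM TM] M(1) sqrt2_mult(1)
    by (simp add: T(2) mult_smult_assoc_mat[of _ d d _ d])
  then show ?thesis using M by (rule smult_eq_smult_imp)
qed

text \<open>Translates between the eigenvalue equation of a term of the metric, which is a signed
  multiple of a parity, and the stabilizer equation of the parity itself. Both directions occur: for
  optimal strategies and for the ideal one.\<close>

lemma scaled_eigen:
  assumes c: "c \<noteq> (0 :: complex)" and P: "P \<in> carrier_mat d d" and M: "M \<in> carrier_mat d d"
  shows "((- 1) ^ k * c) \<cdot>\<^sub>m P * M = c \<cdot>\<^sub>m M \<longleftrightarrow> P * M = (- 1) ^ k \<cdot>\<^sub>m M"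
proof
  have e: "((- 1) ^ k * c) \<cdot>\<^sub>m P * M = ((- 1) ^ k * c) \<cdot>\<^sub>m (P * M)"
    using P M by (rule mult_smult_assoc_mat)
  {
    assume "((- 1) ^ k * c) \<cdot>\<^sub>m P * M = c \<cdot>\<^sub>m M"
    then have "((- 1) ^ k / c) \<cdot>\<^sub>m (((- 1) ^ k * c) \<cdot>\<^sub>m (P * M)) = ((- 1) ^ k / c) \<cdot>\<^sub>m (c \<cdot>\<^sub>m M)"
      unfolding e by simp
    then have "((- 1) ^ k / c * ((- 1) ^ k * c)) \<cdot>\<^sub>m (P * M) = ((- 1) ^ k / c * c) \<cdot>\<^sub>m M"
      unfolding smult_smult_mat .
    moreover have "(- 1) ^ k / c * ((- 1) ^ k * c) = 1" "(- 1) ^ k / c * c = (- 1) ^ k"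
      using c by (simp_all add: power_mult_distrib[symmetric])
    ultimately have "1 \<cdot>\<^sub>m (P * M) = (- 1) ^ k \<cdot>\<^sub>m M" by simp
    then show "P * M = (- 1) ^ k \<cdot>\<^sub>m M" by simp
  }
  assume "P * M = (- 1) ^ k \<cdot>\<^sub>m M"
  then show "((- 1) ^ k * c) \<cdot>\<^sub>m P * M = c \<cdot>\<^sub>m M" unfolding e
    by (simp add: smult_smult_mat mult_ac)
qed

lemma tensor_scaled_parity_X:
  assumes n: "n \<ge> 1" and A: "\<And>i. i \<in> {1..n} \<Longrightarrow> A i = (if i = 1 then c else 1) \<cdot>\<^sub>m pauli 0 1"
  shows "tensor n A = c \<cdot>\<^sub>m parity_X n"
proof -
  have "tensor n A = tensor n (\<lambda>i. (if i = 1 then c else 1) \<cdot>\<^sub>m pauli 0 1)"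
    using A by (rule tensor_cong)
  then show ?thesis using n by (simp add: tensor_smult parity_X_def)
qed

lemma tensor_scaled_parity_Z:
  assumes n: "n \<ge> 1"
    and A: "\<And>i. i \<in> {1..n} \<Longrightarrow> A i = (if i = 1 then c else 1) \<cdot>\<^sub>m (if i = 1 \<or> i = j then pauli 1 0 else 1\<^sub>m 2)"
  shows "tensor n A = c \<cdot>\<^sub>m parity_Z n j"
proof -
  have "tensor n A = tensor n (\<lambda>i. (if i = 1 then c else 1) \<cdot>\<^sub>m (if i = 1 \<or> i = j then pauli 1 0 else 1\<^sub>m 2))"
    using A by (rule tensor_cong)
  then show ?thesis using n by (simp add: tensor_smult parity_Z_def)
qed

context pauli_strategy
begin

text \<open>The traces of the effects add up to \<open>2 ^ n\<close>, so not all effects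
  vanish.\<close>

lemma nonzero_effect: obtains s where "s \<in> bitstrings n" "M s \<noteq> 0\<^sub>m N N"
proof (rule ccontr)
  assume "\<not> thesis"
  then have "\<And>s. s \<in> bitstrings n \<Longrightarrow> M s = 0\<^sub>m N N" using that by blast
  then show False using sum_trace_M by (simp add: mat_trace_def)
qed

text \<open>The eigenvalue equations also fix the scalars: by \<open>eigen_square\<close> on a
  nonzero effect, \<open>t\<close> and \<open>u j\<close> are both 2, so both parts of the defect
  vanish.\<close>

lemma defect_eq_0I:
  assumes 1: "\<And>s. s \<in> bitstrings n \<Longrightarrow> T1 s * M s = complex_of_real (sqrt 2) \<cdot>\<^sub>m M s"
    and 2: "\<And>s j. s \<in> bitstrings n \<Longrightarrow> j \<in> {2..n} \<Longrightarrow> T2 s j * M s = complex_of_real (sqrt 2) \<cdot>\<^sub>m M s"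
  shows "defect = 0"
  unfolding defect_def
proof (intro sum.neutral ballI)
  fix j assume j: "j \<in> {2..n}"
  obtain s where s: "s \<in> bitstrings n" "M s \<noteq> 0\<^sub>m N N" by (rule nonzero_effect)
  have "complex_of_real t = 2"
    by (rule eigen_square[OF T_carrier(1) T1_square povmD(2)[OF povm s(1)] s(2) 1[OF s(1)]])
  moreover have "complex_of_real (u j) = 2"
    by (rule eigen_square[OF T_carrier(2) T2_square[OF j] povmD(2)[OF povm s(1)] s(2) 2[OF s(1) j]])
  moreover have "G1 s = 0" "G2 s j = 0" if "s \<in> bitstrings n" for s
    unfolding G1_def G2_def
    using 1[OF that] 2[OF that j] mat_trace_sos_eq_0_iff[OF povmD(1)[OF povm that]] T_adjoint by auto
  ultimately show "of_real (4 - t - u j) * 2 ^ n + (\<Sum>s\<in>bitstrings n. G1 s + G2 s j) = 0"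
    by simp
qed

context
  assumes opt: "defect = 0"
begin

lemma T1_M: "s \<in> bitstrings n \<Longrightarrow> T1 s * M s = complex_of_real (sqrt 2) \<cdot>\<^sub>m M s"
  \<comment> \<open>Any index \<open>j\<close> would serve; \<open>2\<close> is one because
    \<open>n\<close> is at least 2.\<close>
  using defect_eq_0D(2)[OF opt, of 2 s] n mat_trace_sos_eq_0_iff[OF povmD(1)[OF povm], of s "T1 s"] T_adjoint
  by (simp add: G1_def)

lemma T2_M: "s \<in> bitstrings n \<Longrightarrow> j \<in> {2..n} \<Longrightarrow> T2 s j * M s = complex_of_real (sqrt 2) \<cdot>\<^sub>m M s"
  using defect_eq_0D(3)[OF opt, of j s] mat_trace_sos_eq_0_iff[OF povmD(1)[OF povm], of s "T2 s j"] T_adjoint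
  by (simp add: G2_def)

lemma t_eq: "t = 2" and u_eq: "j \<in> {2..n} \<Longrightarrow> u j = 2"
proof -
  obtain s where s: "s \<in> bitstrings n" "M s \<noteq> 0\<^sub>m N N" by (rule nonzero_effect)
  have "complex_of_real t = 2"
    by (rule eigen_square[OF T_carrier(1) T1_square povmD(2)[OF povm s(1)] s(2) T1_M[OF s(1)]])
  then show "t = 2" using of_real_eq_iff[of t 2, where 'a = complex] by simp
  assume j: "j \<in> {2..n}"
  have "complex_of_real (u j) = 2"
    by (rule eigen_square[OF T_carrier(2) T2_square[OF j] povmD(2)[OF povm s(1)] s(2) T2_M[OF s(1) j]])
  then show "u j = 2" using of_real_eq_iff[of "u j" 2, where 'a = complex] by simp
qed

text \<open>Squeezed: \<open>t\<close> and \<open>u 2\<close> are 2 and bound the two lengths from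
  below, while the sum of the lengths is at most 4.\<close>

lemma SD_len_eq: "S_len = 2" "D_len = 2"
  using t_le t_eq u_le[of 2] u_eq[of 2] SD_len_le n by auto

text \<open>For sender 1, two numbers in [0, 1] have sum 2. For the others, \<open>t = 2\<close>
  makes a product of numbers in [0, 1] equal to 1, so each factor is 1, and \<open>u j = 2\<close>
  settles the second observable.\<close>

lemma len_eq:
  assumes j: "j \<in> {1..n}" and x: "x \<in> {0, 1}"
  shows "len j x = 1"
proof -
  have 1: "len 1 0 = 1 \<and> len 1 1 = 1"
    using SD_len(3) SD_len_eq len_bounds[of 1 0] len_bounds[of 1 1] n by auto
  have 0: "len j 0 = 1" if j: "j \<in> {2..n}"
  proof -
    have "1 = (\<Prod>i\<in>{2..n}. len i 0)" using t_eq SD_len_eq by (simp add: t_def)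
    also have "\<dots> = len j 0 * (\<Prod>i\<in>{2..n} - {j}. len i 0)" using j by (intro prod.remove) auto
    also have "\<dots> \<le> len j 0"
      using len_bounds j by (intro mult_right_le_one_le prod_nonneg prod_le_1) auto
    finally show ?thesis using len_bounds[of j 0] j by auto
  qed
  have "len j 1 = 1" if "j \<in> {2..n}"
    using u_eq[OF that] SD_len_eq by (simp add: u_def)
  moreover have "j = 1 \<or> j \<in> {2..n}" using j by auto
  ultimately show ?thesis using 0 1 x by auto
qed

text \<open>For Bloch vectors r0 and r1 the inner product of r0 + r1 and r0 - r1 is the difference
  of the squared lengths, and both lengths are 1.\<close>

lemma SD_dot: "pauli_dot (a 1 0 + a 1 1) (b 1 0 + b 1 1) (a 1 0 - a 1 1) (b 1 0 - b 1 1) = 0"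
proof -
  have "pauli_dot (a 1 0 + a 1 1) (b 1 0 + b 1 1) (a 1 0 - a 1 1) (b 1 0 - b 1 1) = len 1 0 - len 1 1"
    unfolding pauli_dot_def len_def cmod_power2 by (simp add: power2_eq_square algebra_simps)
  then show ?thesis using len_eq[of 1] n by simp
qed

lemma DS_eq: "D_op * S_op = (- 1) \<cdot>\<^sub>m (S_op * D_op)"
proof -
  have "S_op * D_op + D_op * S_op = 0\<^sub>m 2 2"
    unfolding S_op_def D_op_def pauli_anticomm SD_dot by (intro eq_matI) auto
  then have "(S_op * D_op + D_op * S_op) $$ (i, k) = 0" if "i < 2" "k < 2" for i k using that by simp
  then have *: "(D_op * S_op) $$ (i, k) = - (S_op * D_op) $$ (i, k)" if "i < 2" "k < 2" for i k
    using that SD_carrier by (simp add: eq_neg_iff_add_eq_0 add.commute del: index_mult_mat(1) SD_carrier)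
  show ?thesis using * SD_carrier by (intro eq_matI) (auto simp del: index_mult_mat(1) SD_carrier)
qed

text \<open>\<open>T1\<close> and \<open>T2\<close> commute on the range of \<open>M s\<close>, while their qubit-1 factors anticommute; so
  the qubit-\<open>j\<close> factors must anticommute as well.\<close>

lemma sender_dot:
  assumes j: "j \<in> {2..n}"
  shows "pauli_dot (a j 0) (b j 0) (a j 1) (b j 1) = 0"
proof (rule ccontr)
  assume dot: "pauli_dot (a j 0) (b j 0) (a j 1) (b j 1) \<noteq> 0"
  obtain s where s: "s \<in> bitstrings n" "M s \<noteq> 0\<^sub>m N N" by (rule nonzero_effect)
  note MC = povmD(2)[OF povm s(1)]
  let ?P = "\<lambda>i. pauli (a i 0) (b i 0)" and ?Q = "pauli (a j 1) (b j 1)"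
  \<comment> \<open>The common factors of the products in both orders. Slot \<open>j\<close> is
    overwritten with \<open>?P j * ?Q\<close>, \<open>?Q * ?P j\<close>, their sum or the
    identity.\<close>
  define F where "F = (\<lambda>i. if i = 1 then S_op * D_op else ?P i)"
  define \<epsilon> :: complex where "\<epsilon> = (- 1) ^ s 1 * (- 1) ^ s j"
  have \<epsilon>: "\<epsilon> * \<epsilon> = 1" by (simp add: \<epsilon>_def mult_ac)
  have SD: "S_op * D_op \<in> carrier_mat 2 2" "D_op * S_op \<in> carrier_mat 2 2"
    by (auto intro!: square_mult_carrier)
  have PQ: "?P j * ?Q \<in> carrier_mat 2 2" "?Q * ?P j \<in> carrier_mat 2 2"
    by (auto intro!: square_mult_carrier)
  have F: "F i \<in> carrier_mat 2 2" for i using SD by (simp add: F_def)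
  have tF: "tensor n (F(j := X)) \<in> carrier_mat N N" if "X \<in> carrier_mat 2 2" for X
    using F that by (intro tensor_carrier) auto
  let ?A1 = "\<lambda>i. if i = 1 then S_op else ?P i"
  let ?A2 = "\<lambda>i. if i = 1 then D_op else if i = j then pauli (a i 1) (b i 1) else 1\<^sub>m 2"
  have A: "?A1 i \<in> carrier_mat 2 2" "?A2 i \<in> carrier_mat 2 2" for i by auto
  have tA: "tensor n ?A1 \<in> carrier_mat N N" "tensor n ?A2 \<in> carrier_mat N N"
    by (auto intro!: tensor_carrier)
  have "tensor n ?A1 * tensor n ?A2 = tensor n (\<lambda>i. ?A1 i * ?A2 i)"
    using A by (intro tensor_mult)
  also have "\<dots> = tensor n (F(j := ?P j * ?Q))"
    using j by (intro tensor_cong) (auto simp: F_def right_mult_one_mat[OF pauli_carrier])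
  finally have 12: "T1 s * T2 s j = \<epsilon> \<cdot>\<^sub>m tensor n (F(j := ?P j * ?Q))"
    using tA by (simp add: T1_def T2_def mult_smult_assoc_mat[of _ N N _ N]
        mult_smult_distrib[of _ N N _ N] smult_smult_mat \<epsilon>_def mult.commute)
  have "tensor n ?A2 * tensor n ?A1 = tensor n (\<lambda>i. ?A2 i * ?A1 i)"
    using A by (intro tensor_mult)
  \<comment> \<open>Reversing the order on qubit 1 costs a sign, since \<open>S_op\<close> and
    \<open>D_op\<close> anticommute.\<close>
  also have "\<dots> = tensor n (\<lambda>i. (if i = 1 then - 1 else 1) \<cdot>\<^sub>m (F(j := ?Q * ?P j)) i)"
    using j by (intro tensor_cong) (auto simp: F_def left_mult_one_mat[OF pauli_carrier] DS_eq)
  also have "\<dots> = (- 1) \<cdot>\<^sub>m tensor n (F(j := ?Q * ?P j))"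
    unfolding tensor_smult using n by (simp del: fun_upd_apply)
  finally have 21: "T2 s j * T1 s = (- \<epsilon>) \<cdot>\<^sub>m tensor n (F(j := ?Q * ?P j))"
    using tA by (simp add: T1_def T2_def mult_smult_assoc_mat[of _ N N _ N]
        mult_smult_distrib[of _ N N _ N] smult_smult_mat \<epsilon>_def mult_ac)
  have M12: "T1 s * T2 s j * M s = 2 \<cdot>\<^sub>m M s" "T2 s j * T1 s * M s = 2 \<cdot>\<^sub>m M s"
    using eigen_mult[OF T_carrier(1) T_carrier(2) MC T1_M[OF s(1)] T2_M[OF s(1) j]]
      eigen_mult[OF T_carrier(2) T_carrier(1) MC T2_M[OF s(1) j] T1_M[OF s(1)]]
    by (simp_all add: sqrt2_mult)
  have PQM: "tensor n (F(j := ?P j * ?Q)) * M s = (2 * \<epsilon>) \<cdot>\<^sub>m M s"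
    using arg_cong[OF M12(1), of "(\<cdot>\<^sub>m) \<epsilon>"] tF[OF PQ(1)] MC
    by (simp add: 12 mult_smult_assoc_mat[of _ N N _ N] smult_smult_mat \<epsilon> mult.commute)
  have QPM: "tensor n (F(j := ?Q * ?P j)) * M s = (- 2 * \<epsilon>) \<cdot>\<^sub>m M s"
    using arg_cong[OF M12(2), of "(\<cdot>\<^sub>m) (- \<epsilon>)"] tF[OF PQ(2)] MC
    by (simp add: 21 mult_smult_assoc_mat[of _ N N _ N] smult_smult_mat \<epsilon> mult.commute)
  define c where "c = complex_of_real (2 * pauli_dot (a j 0) (b j 0) (a j 1) (b j 1))"
  have c: "c \<noteq> 0" using dot by (simp add: c_def)
  \<comment> \<open>The anticommutator in slot \<open>j\<close> is the scalar \<open>c\<close>, so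
    the two products add up to \<open>c\<close> times \<open>K\<close>. Their eigenvalues on
    \<open>M s\<close> are opposite, hence \<open>K\<close> annihilates \<open>M s\<close>.\<close>
  define K where "K = tensor n (F(j := 1\<^sub>m 2))"
  have K: "K \<in> carrier_mat N N" unfolding K_def by (rule tF) simp
  have "c \<cdot>\<^sub>m K = tensor n (\<lambda>i. (if i = j then c else 1) \<cdot>\<^sub>m (F(j := 1\<^sub>m 2)) i)"
    unfolding tensor_smult K_def using j by (simp del: fun_upd_apply)
  also have "\<dots> = tensor n (F(j := ?P j * ?Q + ?Q * ?P j))"
    unfolding pauli_anticomm c_def by (intro tensor_cong) auto
  also have "\<dots> = tensor n (F(j := ?P j * ?Q)) + tensor n (F(j := ?Q * ?P j))"
    using j PQ F by (intro tensor_add) auto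
  finally have "(c \<cdot>\<^sub>m K) * M s = 0 \<cdot>\<^sub>m M s"
    using tF[OF PQ(1)] tF[OF PQ(2)] MC
    by (simp add: add_mult_distrib_mat[of _ N N _ _ N] PQM QPM) auto
  then have "(1 / c) \<cdot>\<^sub>m (c \<cdot>\<^sub>m (K * M s)) = (1 / c) \<cdot>\<^sub>m (0 \<cdot>\<^sub>m M s)"
    using K MC by (simp add: mult_smult_assoc_mat[of _ N N _ N])
  then have KM: "K * M s = 0 \<cdot>\<^sub>m M s" using c by (simp add: smult_smult_mat)
  \<comment> \<open>A left inverse of \<open>K\<close> up to the factor 4, which is the product of
    \<open>S_len\<close> and \<open>D_len\<close>: reversing the order cancels the factor on qubit
    1, and the remaining observables square to 1. So \<open>K\<close> cannot annihilate the nonzero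
    \<open>M s\<close>.\<close>
  define K' where "K' = tensor n (\<lambda>i. if i = 1 then D_op * S_op else if i = j then 1\<^sub>m 2 else ?P i)"
  have K': "K' \<in> carrier_mat N N" unfolding K'_def using SD by (auto intro!: tensor_carrier)
  have DSSD: "D_op * S_op * (S_op * D_op) = 4 \<cdot>\<^sub>m 1\<^sub>m 2"
  proof -
    have "D_op * S_op * (S_op * D_op) = D_op * ((S_op * S_op) * D_op)"
      by (simp add: assoc_mult_mat[of _ 2 2 _ 2 _ 2] square_mult_carrier)
    then show ?thesis
      by (simp add: SD_square SD_len_eq mult_smult_assoc_mat[of _ 2 2 _ 2] mult_smult_distrib[of _ 2 2 _ 2]
          left_mult_one_mat[OF SD_carrier(2)] smult_smult_mat)
  qed
  have "K' * K = (\<Prod>i\<in>{1..n}. if i = 1 then 4 else 1) \<cdot>\<^sub>m 1\<^sub>m N"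
    unfolding K_def K'_def
  proof (rule tensor_mult_scalar)
    fix i assume i: "i \<in> {1..n}"
    have "?P i * ?P i = 1 \<cdot>\<^sub>m 1\<^sub>m 2" using len_eq[OF i, of 0] by (simp add: pauli_square len_def)
    then show "(if i = 1 then D_op * S_op else if i = j then 1\<^sub>m 2 else ?P i) * (F(j := 1\<^sub>m 2)) i
      = (if i = 1 then 4 else 1) \<cdot>\<^sub>m 1\<^sub>m 2"
      using j DSSD by (auto simp: F_def)
  qed (use F SD in auto)
  then have "K' * K * M s = 4 \<cdot>\<^sub>m M s"
    using n MC by (simp add: mult_smult_assoc_mat[of _ N N _ N])
  moreover have "K' * K * M s = 0 \<cdot>\<^sub>m M s"
    using K K' MC KM by (simp add: assoc_mult_mat[of _ N N _ N _ N] mult_smult_distrib[of _ N N _ N])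
      auto
  ultimately have "4 \<cdot>\<^sub>m M s = 0 \<cdot>\<^sub>m M s" by simp
  from smult_eq_smult_imp[OF this MC s(2)] show False by simp
qed

lemma local_unitaries:
  obtains U where "\<And>j. j \<in> {1..n} \<Longrightarrow> unitary_mat 2 (U j)"
    "conj_by (U 1) S_op = complex_of_real (sqrt 2) \<cdot>\<^sub>m pauli 0 1"
    "conj_by (U 1) D_op = complex_of_real (sqrt 2) \<cdot>\<^sub>m pauli 1 0"
    "\<And>j. j \<in> {2..n} \<Longrightarrow> conj_by (U j) (pauli (a j 0) (b j 0)) = pauli 0 1"
    "\<And>j. j \<in> {2..n} \<Longrightarrow> conj_by (U j) (pauli (a j 1) (b j 1)) = pauli 1 0"
proof -
  \<comment> \<open>\<open>S_op\<close> and \<open>D_op\<close> have squared length 2; dividing by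
    sqrt 2 gives the unit Bloch vectors that \<open>pauli_pair_unitary\<close> expects.\<close>
  let ?r = "1 / sqrt 2"
  have "\<exists>V. unitary_mat 2 V \<and> conj_by V (pauli (a j 0) (b j 0)) = pauli 0 1 \<and>
      conj_by V (pauli (a j 1) (b j 1)) = pauli 1 0" if j: "j \<in> {2..n}" for j
  proof -
    have "(a j 0)\<^sup>2 + (cmod (b j 0))\<^sup>2 = 1" "(a j 1)\<^sup>2 + (cmod (b j 1))\<^sup>2 = 1"
      using len_eq[of j 0] len_eq[of j 1] j by (simp_all add: len_def)
    from pauli_pair_unitary[OF this sender_dot[OF j]] show ?thesis by blast
  qed
  then obtain V where V: "\<And>j. j \<in> {2..n} \<Longrightarrow> unitary_mat 2 (V j)"
      "\<And>j. j \<in> {2..n} \<Longrightarrow> conj_by (V j) (pauli (a j 0) (b j 0)) = pauli 0 1"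
      "\<And>j. j \<in> {2..n} \<Longrightarrow> conj_by (V j) (pauli (a j 1) (b j 1)) = pauli 1 0"
    by metis
  have sc: "(?r * x)\<^sup>2 + (cmod (of_real ?r * y))\<^sup>2 = (x\<^sup>2 + (cmod y)\<^sup>2) / 2" for x y
    by (simp add: norm_mult norm_divide power_mult_distrib power_divide add_divide_distrib)
  have sd: "pauli_dot (?r * x) (of_real ?r * y) (?r * x') (of_real ?r * y') = pauli_dot x y x' y' / 2" for x y x' y'
    by (simp add: pauli_dot_def add_divide_distrib)
  obtain V1 where V1: "unitary_mat 2 V1"
    "conj_by V1 (pauli (?r * (a 1 0 + a 1 1)) (of_real ?r * (b 1 0 + b 1 1))) = pauli 0 1"
    "conj_by V1 (pauli (?r * (a 1 0 - a 1 1)) (of_real ?r * (b 1 0 - b 1 1))) = pauli 1 0"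
  proof (rule pauli_pair_unitary)
    show "(?r * (a 1 0 + a 1 1))\<^sup>2 + (cmod (of_real ?r * (b 1 0 + b 1 1)))\<^sup>2 = 1"
      "(?r * (a 1 0 - a 1 1))\<^sup>2 + (cmod (of_real ?r * (b 1 0 - b 1 1)))\<^sup>2 = 1"
      using SD_len_eq unfolding sc S_len_def D_len_def by simp_all
    show "pauli_dot (?r * (a 1 0 + a 1 1)) (of_real ?r * (b 1 0 + b 1 1))
        (?r * (a 1 0 - a 1 1)) (of_real ?r * (b 1 0 - b 1 1)) = 0"
      unfolding sd SD_dot by simp
  qed
  have resc: "conj_by V1 (pauli x y) = complex_of_real (sqrt 2) \<cdot>\<^sub>m P"
    if "conj_by V1 (pauli (?r * x) (of_real ?r * y)) = P" for x y P
  proof -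
    have "pauli x y = of_real (sqrt 2) \<cdot>\<^sub>m pauli (?r * x) (of_real ?r * y)"
      unfolding pauli_smult by simp
    then show ?thesis using that unitary_matD(1)[OF V1(1)] by (simp add: conj_by_smult[of _ 2])
  qed
  show ?thesis
  proof (rule that[of "V(1 := V1)"])
    show "\<And>j. j \<in> {1..n} \<Longrightarrow> unitary_mat 2 ((V(1 := V1)) j)" using V(1) V1(1) by auto
    show "conj_by ((V(1 := V1)) 1) S_op = complex_of_real (sqrt 2) \<cdot>\<^sub>m pauli 0 1"
      "conj_by ((V(1 := V1)) 1) D_op = complex_of_real (sqrt 2) \<cdot>\<^sub>m pauli 1 0"
      using resc[OF V1(2)] resc[OF V1(3)] by (simp_all add: S_op_def D_op_def)
  qed (use V in auto)
qed

text \<open>The conjugated effects again sum to the identity. The local unitaries turn the terms of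
  the metric into signed sqrt 2 multiples of the parities, so the eigenvalue equations become the
  stabilizer equations that characterize the basis projectors.\<close>

lemma effects_eq_proj_xi:
  assumes U: "\<And>j. j \<in> {1..n} \<Longrightarrow> unitary_mat 2 (U j)"
    and U1: "conj_by (U 1) S_op = complex_of_real (sqrt 2) \<cdot>\<^sub>m pauli 0 1"
      "conj_by (U 1) D_op = complex_of_real (sqrt 2) \<cdot>\<^sub>m pauli 1 0"
    and Uj: "\<And>j. j \<in> {2..n} \<Longrightarrow> conj_by (U j) (pauli (a j 0) (b j 0)) = pauli 0 1"
      "\<And>j. j \<in> {2..n} \<Longrightarrow> conj_by (U j) (pauli (a j 1) (b j 1)) = pauli 1 0"
    and s: "s \<in> bitstrings n"
  shows "conj_by (tensor n U) (M s) = proj (xi n s)"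
proof -
  let ?c = "complex_of_real (sqrt 2)"
  let ?U = "tensor n U"
  have V: "unitary_mat N ?U" using U by (rule unitary_tensor)
  note VC = unitary_matD(1)[OF V]
  note UC = unitary_matD(1)[OF U]
  have 1: "conj_by ?U (T1 s) = ((- 1) ^ s 1 * ?c) \<cdot>\<^sub>m parity_X n" for s
  proof -
    have "conj_by ?U (tensor n (\<lambda>i. if i = 1 then S_op else pauli (a i 0) (b i 0))) = ?c \<cdot>\<^sub>m parity_X n"
      using n U1 Uj by (subst conj_by_tensor[OF UC]) (auto intro!: tensor_scaled_parity_X)
    then show ?thesis unfolding T1_def
      using VC by (subst conj_by_smult[of _ N]) (auto simp: smult_smult_mat intro!: tensor_carrier)
  qed
  have 2: "conj_by ?U (T2 s j) = ((- 1) ^ s j * ?c) \<cdot>\<^sub>m parity_Z n j" if "j \<in> {2..n}" for s j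
  proof -
    have "conj_by ?U (tensor n (\<lambda>i. if i = 1 then D_op else if i = j then pauli (a i 1) (b i 1) else 1\<^sub>m 2))
        = ?c \<cdot>\<^sub>m parity_Z n j"
      using n U1 Uj U that
      by (subst conj_by_tensor[OF UC]) (auto intro!: tensor_scaled_parity_Z simp: conj_by_one)
    then show ?thesis unfolding T2_def
      using VC by (subst conj_by_smult[of _ N]) (auto simp: smult_smult_mat intro!: tensor_carrier)
  qed
  have c: "?c \<noteq> 0" by simp
  show ?thesis
  proof (rule povm_stabilized_eq_proj_xi[OF _ _ _ _ _ _ s, where M = "\<lambda>s. conj_by ?U (M s)"])
    show "n \<ge> 1" using n by simp
    show "mat_sum N (\<lambda>s. conj_by ?U (M s)) (bitstrings n) = 1\<^sub>m N"
      using conj_by_mat_sum[OF VC, of "bitstrings n" M] povmD(2,4)[OF povm] by (simp add: conj_by_one[OF V])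
  next
    fix s assume s: "s \<in> bitstrings n"
    note MC = povmD(2)[OF povm s]
    show MC': "conj_by ?U (M s) \<in> carrier_mat N N" using VC MC by simp
    show "mat_adjoint (conj_by ?U (M s)) = conj_by ?U (M s)"
      using conj_by_adjoint[OF VC MC] povmD(3)[OF povm s] by simp
    have eig: "conj_by ?U T * conj_by ?U (M s) = ?c \<cdot>\<^sub>m conj_by ?U (M s)"
      if "T * M s = ?c \<cdot>\<^sub>m M s" "T \<in> carrier_mat N N" for T
      using conj_by_mult[OF V that(2) MC] that(1) conj_by_smult[OF VC MC] by simp
    show "parity_X n * conj_by ?U (M s) = (- 1) ^ s 1 \<cdot>\<^sub>m conj_by ?U (M s)"
      using eig[OF T1_M[OF s]] scaled_eigen[OF c parity_carrier(1) MC'] by (simp add: 1)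
    fix j assume j: "j \<in> {2..n}"
    show "parity_Z n j * conj_by ?U (M s) = (- 1) ^ s j \<cdot>\<^sub>m conj_by ?U (M s)"
      using eig[OF T2_M[OF s j]] scaled_eigen[OF c parity_carrier(2) MC'] by (simp add: 2[OF j])
  qed
qed

end
end

text \<open>The second conclusion lets the states be rebuilt from the observables once the Bloch
  vectors are known to have length 1.\<close>

lemma pauli_strategy_exists:
  assumes n: "n \<ge> 2" and \<rho>: "qubit_states n \<rho>" and M: "povm n M"
  obtains a b where "pauli_strategy n \<rho> M a b"
    "\<forall>j\<in>{1..n}. \<forall>x\<in>{0, 1}. (a j x)\<^sup>2 + (cmod (b j x))\<^sup>2 = 1 \<longrightarrow>
      \<rho> j 0 x = (1 / 2) \<cdot>\<^sub>m (1\<^sub>m 2 + pauli (a j x) (b j x)) \<and>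
      \<rho> j 1 x = (1 / 2) \<cdot>\<^sub>m (1\<^sub>m 2 - pauli (a j x) (b j x))"
proof -
  have "\<exists>c w. obs \<rho> j x = pauli c w \<and> c\<^sup>2 + (cmod w)\<^sup>2 \<le> 1 \<and>
      (c\<^sup>2 + (cmod w)\<^sup>2 = 1 \<longrightarrow> \<rho> j 0 x = (1 / 2) \<cdot>\<^sub>m (1\<^sub>m 2 + pauli c w) \<and>
        \<rho> j 1 x = (1 / 2) \<cdot>\<^sub>m (1\<^sub>m 2 - pauli c w))" if "j \<in> {1..n}" "x \<in> {0, 1}" for j x
  proof -
    have "density (\<rho> j 0 x)" "density (\<rho> j 1 x)" using \<rho> that by (auto simp: qubit_states_def)
    from obs_pauli[OF this] show ?thesis unfolding obs_def by blast
  qed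
  then obtain a b where ab: "\<And>j x. j \<in> {1..n} \<Longrightarrow> x \<in> {0, 1} \<Longrightarrow> obs \<rho> j x = pauli (a j x) (b j x) \<and>
      (a j x)\<^sup>2 + (cmod (b j x))\<^sup>2 \<le> 1 \<and>
      ((a j x)\<^sup>2 + (cmod (b j x))\<^sup>2 = 1 \<longrightarrow> \<rho> j 0 x = (1 / 2) \<cdot>\<^sub>m (1\<^sub>m 2 + pauli (a j x) (b j x)) \<and>
        \<rho> j 1 x = (1 / 2) \<cdot>\<^sub>m (1\<^sub>m 2 - pauli (a j x) (b j x)))"
    by metis
  show ?thesis
  proof (rule that)
    show "pauli_strategy n \<rho> M a b" using n M ab by unfold_locales blast+
  qed (use ab in blast)
qed

section \<open>The ideal states and measurement\<close>

lemma pauli_inject: "pauli a b = pauli a' b' \<longleftrightarrow> a = a' \<and> b = b'"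
  by (auto simp: pauli_def)

lemma cos_sin_pi8:
  "complex_of_real (cos (pi / 8)) * complex_of_real (cos (pi / 8)) = of_real (1 / 2 + sqrt 2 / 4)"
  "complex_of_real (sin (pi / 8)) * complex_of_real (sin (pi / 8)) = of_real (1 / 2 - sqrt 2 / 4)"
  "complex_of_real (sin (pi / 8)) * complex_of_real (cos (pi / 8)) = of_real (sqrt 2 / 4)"
  "complex_of_real (cos (pi / 8)) * complex_of_real (sin (pi / 8)) = of_real (sqrt 2 / 4)"
proof -
  have "2 * (cos (pi / 8))\<^sup>2 - 1 = sqrt 2 / 2"
    using cos_double_cos[of "pi / 8"] by (simp add: cos_45)
  then have c: "(cos (pi / 8))\<^sup>2 = 1 / 2 + sqrt 2 / 4" by linarith
  have "2 * (sin (pi / 8) * cos (pi / 8)) = sqrt 2 / 2"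
    using sin_double[of "pi / 8"] by (simp add: sin_45)
  then have sc: "sin (pi / 8) * cos (pi / 8) = sqrt 2 / 4" by linarith
  have "cos (pi / 8) * cos (pi / 8) = 1 / 2 + sqrt 2 / 4" "sin (pi / 8) * sin (pi / 8) = 1 / 2 - sqrt 2 / 4"
    "sin (pi / 8) * cos (pi / 8) = sqrt 2 / 4" "cos (pi / 8) * sin (pi / 8) = sqrt 2 / 4"
    using c sc sin_squared_eq[of "pi / 8"] by (simp_all add: power2_eq_square mult.commute)
  then show "complex_of_real (cos (pi / 8)) * complex_of_real (cos (pi / 8)) = of_real (1 / 2 + sqrt 2 / 4)"
    "complex_of_real (sin (pi / 8)) * complex_of_real (sin (pi / 8)) = of_real (1 / 2 - sqrt 2 / 4)"
    "complex_of_real (sin (pi / 8)) * complex_of_real (cos (pi / 8)) = of_real (sqrt 2 / 4)"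
    "complex_of_real (cos (pi / 8)) * complex_of_real (sin (pi / 8)) = of_real (sqrt 2 / 4)"
    by (simp_all only: of_real_mult[symmetric])
qed

text \<open>The Bloch vectors behind the angle pi / 8: the \<beta> pair belongs to (X + Z) / sqrt 2
  and the \<alpha> pair to (X - Z) / sqrt 2, so that the sum and the difference of the two
  observables are sqrt 2 X and sqrt 2 Z.\<close>

lemma proj_states:
  "proj beta_plus = (1 / 2) \<cdot>\<^sub>m (1\<^sub>m 2 + pauli (sqrt 2 / 2) (of_real (sqrt 2 / 2)))"
  "proj beta_minus = (1 / 2) \<cdot>\<^sub>m (1\<^sub>m 2 - pauli (sqrt 2 / 2) (of_real (sqrt 2 / 2)))"
  "proj alpha_plus = (1 / 2) \<cdot>\<^sub>m (1\<^sub>m 2 + pauli (- sqrt 2 / 2) (of_real (sqrt 2 / 2)))"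
  "proj alpha_minus = (1 / 2) \<cdot>\<^sub>m (1\<^sub>m 2 - pauli (- sqrt 2 / 2) (of_real (sqrt 2 / 2)))"
  "proj ket_plus = (1 / 2) \<cdot>\<^sub>m (1\<^sub>m 2 + pauli 0 1)"
  "proj ket_minus = (1 / 2) \<cdot>\<^sub>m (1\<^sub>m 2 - pauli 0 1)"
  "proj (ket 0) = (1 / 2) \<cdot>\<^sub>m (1\<^sub>m 2 + pauli 1 0)"
  "proj (ket 1) = (1 / 2) \<cdot>\<^sub>m (1\<^sub>m 2 - pauli 1 0)"
  by (simp_all add: beta_plus_def beta_minus_def alpha_plus_def alpha_minus_def ket_plus_def ket_minus_def
      ket_def proj_ket2 pauli_def one_mat2 cos_sin_pi8 sqrt2_mult add_divide_distrib diff_divide_distrib)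

definition ideal_ket :: "nat \<Rightarrow> nat \<Rightarrow> nat \<Rightarrow> complex mat" where
  "ideal_ket j a x =
    (if j = 1 then if x = 0 then if a = 0 then beta_plus else beta_minus
       else if a = 0 then alpha_plus else alpha_minus
     else if x = 0 then if a = 0 then ket_plus else ket_minus
       else if a = 0 then ket 0 else ket 1)"

lemma ideal_ket_carrier: "ideal_ket j a x \<in> carrier_mat 2 1"
  by (auto simp: ideal_ket_def beta_plus_def beta_minus_def alpha_plus_def alpha_minus_def ket_plus_def ket_minus_def)

lemma trace_half:
  "mat_trace ((1 / 2) \<cdot>\<^sub>m (1\<^sub>m 2 + pauli a b)) = 1" "mat_trace ((1 / 2) \<cdot>\<^sub>m (1\<^sub>m 2 - pauli a b)) = 1"
  by (simp_all add: pauli_def one_mat2 field_simps)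

lemma ideal_density: "density (proj (ideal_ket j a x))"
  unfolding density_def
proof
  show "psd 2 (proj (ideal_ket j a x))" by (rule psd_proj[OF ideal_ket_carrier])
  show "mat_trace (proj (ideal_ket j a x)) = 1"
    by (simp add: ideal_ket_def proj_states trace_half)
qed

lemma half_diff: "(1 / 2) \<cdot>\<^sub>m (1\<^sub>m 2 + pauli a b) - (1 / 2) \<cdot>\<^sub>m (1\<^sub>m 2 - pauli a b) = pauli a b"
  by (simp add: pauli_def one_mat2 field_simps)

lemma obs_ideal:
  "obs (\<lambda>j a x. proj (ideal_ket j a x)) 1 0 = pauli (sqrt 2 / 2) (of_real (sqrt 2 / 2))"
  "obs (\<lambda>j a x. proj (ideal_ket j a x)) 1 1 = pauli (- sqrt 2 / 2) (of_real (sqrt 2 / 2))"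
  "j \<noteq> 1 \<Longrightarrow> obs (\<lambda>j a x. proj (ideal_ket j a x)) j 0 = pauli 0 1"
  "j \<noteq> 1 \<Longrightarrow> obs (\<lambda>j a x. proj (ideal_ket j a x)) j 1 = pauli 1 0"
  unfolding obs_def ideal_ket_def by (simp_all add: proj_states half_diff)

text \<open>The traces are never evaluated: the terms of the metric are signed sqrt 2 multiples of
  the parities, which stabilize the \<xi> vectors, and so the defect vanishes.\<close>

lemma ideal_strategy_success:
  assumes n: "n \<ge> 2"
  shows "qubit_states n (\<lambda>j a x. proj (ideal_ket j a x)) \<and> povm n (\<lambda>s. proj (xi n s)) \<and>
    success n (\<lambda>j a x. proj (ideal_ket j a x)) (\<lambda>s. proj (xi n s)) = 1"
proof -
  let ?\<rho> = "\<lambda>j a x. proj (ideal_ket j a x)" and ?M = "\<lambda>s. proj (xi n s)" and ?c = "complex_of_real (sqrt 2)"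
  have q: "qubit_states n ?\<rho>" by (simp add: qubit_states_def ideal_density)
  have p: "povm n ?M"
    using n sum_proj_xi[of n] psd_proj[OF xi_carrier] by (simp add: povm_def)
  obtain a b where st: "pauli_strategy n ?\<rho> ?M a b" by (rule pauli_strategy_exists[OF n q p])
  interpret pauli_strategy n ?\<rho> ?M a b by (rule st)
  \<comment> \<open>The Bloch data were obtained from an existence statement; injectivity of
    \<open>pauli\<close> identifies them.\<close>
  have ab: "a 1 0 = sqrt 2 / 2" "b 1 0 = of_real (sqrt 2 / 2)" "a 1 1 = - sqrt 2 / 2" "b 1 1 = of_real (sqrt 2 / 2)"
  proof -
    have "pauli (sqrt 2 / 2) (of_real (sqrt 2 / 2)) = pauli (a 1 0) (b 1 0)"
      "pauli (- sqrt 2 / 2) (of_real (sqrt 2 / 2)) = pauli (a 1 1) (b 1 1)"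
      using obs[of 1 0] obs[of 1 1] n unfolding obs_ideal by simp_all
    then show "a 1 0 = sqrt 2 / 2" "b 1 0 = of_real (sqrt 2 / 2)"
      "a 1 1 = - sqrt 2 / 2" "b 1 1 = of_real (sqrt 2 / 2)"
      unfolding pauli_inject by metis+
  qed
  have ab2: "a j 0 = 0" "b j 0 = 1" "a j 1 = 1" "b j 1 = 0" if "j \<in> {2..n}" for j
    using obs[of j 0] obs[of j 1] obs_ideal(3,4)[of j] that by (auto simp: pauli_inject)
  have S: "S_op = ?c \<cdot>\<^sub>m pauli 0 1" and D: "D_op = ?c \<cdot>\<^sub>m pauli 1 0"
    unfolding S_op_def D_op_def ab by (simp_all add: pauli_def flip: of_real_add)
  have 1: "T1 s = ((- 1) ^ s 1 * ?c) \<cdot>\<^sub>m parity_X n" for s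
    unfolding T1_def using n S ab2
    by (subst tensor_scaled_parity_X[where c = ?c]) (auto simp: smult_smult_mat)
  have 2: "T2 s j = ((- 1) ^ s j * ?c) \<cdot>\<^sub>m parity_Z n j" if "j \<in> {2..n}" for s j
    unfolding T2_def using n D ab2 that
    by (subst tensor_scaled_parity_Z[where c = ?c and j = j]) (auto simp: smult_smult_mat)
  have stab: "P * ?M s = (- 1) ^ k \<cdot>\<^sub>m ?M s"
    if "P * xi n s = (- 1) ^ k \<cdot>\<^sub>m xi n s" "P \<in> carrier_mat N N" for P s k
  proof -
    have "P * ?M s = P * xi n s * mat_adjoint (xi n s)"
      unfolding proj_def using that(2) by (simp add: assoc_mult_mat[of _ N N _ 1 _ N])
    then show ?thesis unfolding that(1) proj_def by (simp add: mult_smult_assoc_mat[of _ N 1 _ N])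
  qed
  have c: "?c \<noteq> 0" by simp
  have pc: "?M s \<in> carrier_mat N N" for s by (rule proj_carrier[OF xi_carrier])
  have "defect = 0"
  proof (rule defect_eq_0I)
    fix s assume s: "s \<in> bitstrings n"
    show "T1 s * ?M s = ?c \<cdot>\<^sub>m ?M s"
      unfolding 1 scaled_eigen[OF c parity_carrier(1) pc]
      using n by (intro stab parity_X_xi[OF s]) auto
    fix j assume j: "j \<in> {2..n}"
    show "T2 s j * ?M s = ?c \<cdot>\<^sub>m ?M s"
      unfolding 2[OF j] scaled_eigen[OF c parity_carrier(2) pc]
      by (intro stab parity_Z_xi[OF s j]) auto
  qed
  then show ?thesis using q p success_1_iff by simp
qed

theorem theorem1:
  fixes n :: nat
  assumes "n \<ge> 2"
  shows "(\<exists>\<rho> M. qubit_states n \<rho> \<and> povm n M \<and> success n \<rho> M = 1) \<and>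
    (\<forall>\<rho> M. qubit_states n \<rho> \<and> povm n M \<longrightarrow> success n \<rho> M \<in> \<real> \<and> Re (success n \<rho> M) \<le> 1) \<and>
    (\<forall>\<rho> M. qubit_states n \<rho> \<and> povm n M \<and> success n \<rho> M = 1 \<longrightarrow>
      (\<exists>U :: nat \<Rightarrow> complex mat.
        (\<forall>j\<in>{1..n}. unitary_mat 2 (U j)) \<and>
        conj_by (U 1) (\<rho> 1 0 0) = proj beta_plus \<and>
        conj_by (U 1) (\<rho> 1 1 0) = proj beta_minus \<and>
        conj_by (U 1) (\<rho> 1 0 1) = proj alpha_plus \<and>
        conj_by (U 1) (\<rho> 1 1 1) = proj alpha_minus \<and>
        (\<forall>j\<in>{2..n}.
          conj_by (U j) (\<rho> j 0 0) = proj ket_plus \<and>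
          conj_by (U j) (\<rho> j 1 0) = proj ket_minus \<and>
          conj_by (U j) (\<rho> j 0 1) = proj (ket 0) \<and>
          conj_by (U j) (\<rho> j 1 1) = proj (ket 1)) \<and>
        (\<forall>s\<in>bitstrings n. conj_by (tensor n U) (M s) = proj (xi n s))))"
proof (intro conjI allI impI)
  show "\<exists>\<rho> M. qubit_states n \<rho> \<and> povm n M \<and> success n \<rho> M = 1"
    using ideal_strategy_success[OF assms] by blast
next
  fix \<rho> M assume "qubit_states n \<rho> \<and> povm n M"
  then have q: "qubit_states n \<rho>" and p: "povm n M" by auto
  obtain a b where "pauli_strategy n \<rho> M a b" by (rule pauli_strategy_exists[OF assms q p])
  then have "success n \<rho> M \<in> \<real> \<and> Re (success n \<rho> M) \<le> 1" by (rule pauli_strategy.success_real_le)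
  then show "success n \<rho> M \<in> \<real>" "Re (success n \<rho> M) \<le> 1" by auto
next
  fix \<rho> M assume *: "qubit_states n \<rho> \<and> povm n M \<and> success n \<rho> M = 1"
  then have q: "qubit_states n \<rho>" and p: "povm n M" by auto
  obtain a b where st: "pauli_strategy n \<rho> M a b"
    and pure: "\<forall>j\<in>{1..n}. \<forall>x\<in>{0, 1}. (a j x)\<^sup>2 + (cmod (b j x))\<^sup>2 = 1 \<longrightarrow>
      \<rho> j 0 x = (1 / 2) \<cdot>\<^sub>m (1\<^sub>m 2 + pauli (a j x) (b j x)) \<and>
      \<rho> j 1 x = (1 / 2) \<cdot>\<^sub>m (1\<^sub>m 2 - pauli (a j x) (b j x))"
    by (rule pauli_strategy_exists[OF assms q p])
  interpret pauli_strategy n \<rho> M a b by (rule st)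
  have opt: "defect = 0" using * success_1_iff by simp
  obtain U where U: "\<And>j. j \<in> {1..n} \<Longrightarrow> unitary_mat 2 (U j)"
    and U1: "conj_by (U 1) S_op = complex_of_real (sqrt 2) \<cdot>\<^sub>m pauli 0 1"
      "conj_by (U 1) D_op = complex_of_real (sqrt 2) \<cdot>\<^sub>m pauli 1 0"
    and Uj: "\<And>j. j \<in> {2..n} \<Longrightarrow> conj_by (U j) (pauli (a j 0) (b j 0)) = pauli 0 1"
      "\<And>j. j \<in> {2..n} \<Longrightarrow> conj_by (U j) (pauli (a j 1) (b j 1)) = pauli 1 0"
    using local_unitaries[OF opt] by blast
  \<comment> \<open>At unit length a state is an affine function of its observable, so conjugating
    the observable determines the conjugated state.\<close>
  have state: "conj_by (U j) (\<rho> j 0 x) = (1 / 2) \<cdot>\<^sub>m (1\<^sub>m 2 + P)" "conj_by (U j) (\<rho> j 1 x) = (1 / 2) \<cdot>\<^sub>m (1\<^sub>m 2 - P)"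
    if "j \<in> {1..n}" "x \<in> {0, 1}" "conj_by (U j) (pauli (a j x) (b j x)) = P" for j x P
  proof -
    have \<rho>: "\<rho> j 0 x = (1 / 2) \<cdot>\<^sub>m (1\<^sub>m 2 + pauli (a j x) (b j x))"
      "\<rho> j 1 x = (1 / 2) \<cdot>\<^sub>m (1\<^sub>m 2 - pauli (a j x) (b j x))"
      using pure[rule_format, OF that(1,2)] len_eq[OF opt that(1,2)] by (simp_all add: len_def)
    note V = U[OF that(1)]
    show "conj_by (U j) (\<rho> j 0 x) = (1 / 2) \<cdot>\<^sub>m (1\<^sub>m 2 + P)" "conj_by (U j) (\<rho> j 1 x) = (1 / 2) \<cdot>\<^sub>m (1\<^sub>m 2 - P)"
      unfolding \<rho> using unitary_matD(1)[OF V] that(3)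
      by (simp_all add: conj_by_smult[of _ 2] conj_by_add[of _ 2] conj_by_minus[of _ 2] conj_by_one[OF V] minus_carrier_mat)
  qed
  have U1C: "U 1 \<in> carrier_mat 2 2" using unitary_matD(1)[OF U[of 1]] n by simp
  \<comment> \<open>\<open>U 1\<close> was chosen for the sum and the difference of the observables;
    half their sum and half their difference give back the observables themselves.\<close>
  have "pauli (a 1 0) (b 1 0) = (1 / 2) \<cdot>\<^sub>m (S_op + D_op)" "pauli (a 1 1) (b 1 1) = (1 / 2) \<cdot>\<^sub>m (S_op - D_op)"
    by (simp_all add: S_op_def D_op_def pauli_def)
  then have A: "conj_by (U 1) (pauli (a 1 0) (b 1 0)) = pauli (sqrt 2 / 2) (of_real (sqrt 2 / 2))"
    "conj_by (U 1) (pauli (a 1 1) (b 1 1)) = pauli (- sqrt 2 / 2) (of_real (sqrt 2 / 2))"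
    using U1C by (simp_all add: conj_by_smult[of _ 2] conj_by_add[of _ 2] conj_by_minus[of _ 2] U1 minus_carrier_mat)
      (simp_all add: pauli_def)
  have n1: "1 \<in> {1..n}" using n by simp
  show "\<exists>U :: nat \<Rightarrow> complex mat.
        (\<forall>j\<in>{1..n}. unitary_mat 2 (U j)) \<and>
        conj_by (U 1) (\<rho> 1 0 0) = proj beta_plus \<and>
        conj_by (U 1) (\<rho> 1 1 0) = proj beta_minus \<and>
        conj_by (U 1) (\<rho> 1 0 1) = proj alpha_plus \<and>
        conj_by (U 1) (\<rho> 1 1 1) = proj alpha_minus \<and>
        (\<forall>j\<in>{2..n}.
          conj_by (U j) (\<rho> j 0 0) = proj ket_plus \<and>
          conj_by (U j) (\<rho> j 1 0) = proj ket_minus \<and>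
          conj_by (U j) (\<rho> j 0 1) = proj (ket 0) \<and>
          conj_by (U j) (\<rho> j 1 1) = proj (ket 1)) \<and>
        (\<forall>s\<in>bitstrings n. conj_by (tensor n U) (M s) = proj (xi n s))"
    unfolding proj_states
  proof (intro exI[of _ U] conjI ballI)
    fix s assume "s \<in> bitstrings n"
    then show "conj_by (tensor n U) (M s) = proj (xi n s)"
      using effects_eq_proj_xi[OF opt U U1 Uj] by blast
  qed (use U state[OF n1 _ A(1)] state[OF n1 _ A(2)] state[OF _ _ Uj(1)] state[OF _ _ Uj(2)] in auto)
qed

end
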